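(* Let $\Sigma$ be an $\mathcal{H}$-hypersurface in $\mathbb{R}^{n+1}$ for some $\mathcal{H}\in C^1(\mathbb{S}^n)$, with unit normal $\eta:\Sigma\to\mathbb{S}^n$, let $f\in C^2_0(\Sigma)$, and for each $t$ small enough let $\Sigma_t$ denote the hypersurface given by the normal variation $$(p,t)\in\Sigma\times(-\varepsilon,\varepsilon)\mapsto p+tf(p)\eta(p).$$ Denote $\hat{\mathcal{H}}(t):=H(t)-\mathcal{H}(\eta^t):\Sigma\times(-\varepsilon,\varepsilon)\to\mathbb{R}$, where $H(t)$ and $\eta^t$ stand, respectively, for the mean curvature and the unit normal of $\Sigma_t$. Then $$n\,\hat{\mathcal{H}}'(0)=\mathcal{L}f,\qquad \mathcal{L}f:=\Delta f+\langle X_{\mathcal{H}},\nabla f\rangle+|\sigma|^2f,$$ where $X_{\mathcal{H}}\in\mathfrak{X}(\Sigma)$ is given for each $p\in\Sigma$ by $X_{\mathcal{H}}(p):=n\nabla_{\mathbb{S}}\mathcal{H}(\eta(p))$; here $\nabla_{\mathbb{S}}$ denotes the gradient in $\mathbb{S}^n$, and $\Delta,\nabla,|\sigma|$ denote, respectively, the Laplacian, gradient and norm of the second fundamental form of $\Sigma$ with its induced metric.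
   Context: Given $\mathcal{H}\in C^1(\mathbb{S}^n)$, an immersed oriented hypersurface $\Sigma$ in $\mathbb{R}^{n+1}$ with unit normal $\eta:\Sigma\to\mathbb{S}^n$ is an $\mathcal{H}$-hypersurface if its mean curvature satisfies $H_\Sigma=\mathcal{H}\circ\eta$. The mean curvature is the average of the principal curvatures, with the convention that the unit sphere with inner orientation has mean curvature $1$. $C^2_0(\Sigma)$ is the space of compactly supported $C^2$ functions, $\mathfrak{X}(\Sigma)$ the space of tangent vector fields on $\Sigma$, the prime denotes the derivative with respect to $t$, and $T_p\Sigma$ is identified with $T_{\eta(p)}\mathbb{S}^n$ as the same linear subspace of $\mathbb{R}^{n+1}$. The unit normal $\eta^t$ depends continuously on $t$ with $\eta^0=\eta$. *)

theory Defs
  imports "HOL-Analysis.Analysis"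
begin

text \<open>Meaningful for open \<open>S\<close>: all iterated directional derivatives up to order \<open>k\<close> exist,
  as Frechet derivatives, and are continuous.\<close>

primrec Ck_on :: "nat \<Rightarrow> (real^'n) set \<Rightarrow> (real^'n \<Rightarrow> 'b::real_normed_vector) \<Rightarrow> bool" where
  "Ck_on 0 S F \<longleftrightarrow> continuous_on S F"
| "Ck_on (Suc k) S F \<longleftrightarrow>
     (\<forall>x\<in>S. F differentiable (at x)) \<and>
     (\<forall>v. Ck_on k S (\<lambda>x. frechet_derivative F (at x) v))"

definition partial :: "'n \<Rightarrow> (real^'n \<Rightarrow> 'b::real_normed_vector) \<Rightarrow> real^'n \<Rightarrow> 'b" where
  "partial i F x = frechet_derivative F (at x) (axis i 1)"

type_synonym ('p, 'n) chart = "'p set \<times> ('p \<Rightarrow> real^'n)"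

abbreviation cdom :: "('p, 'n::finite) chart \<Rightarrow> 'p set" where
  "cdom c \<equiv> fst c"

abbreviation cmap :: "('p, 'n::finite) chart \<Rightarrow> 'p \<Rightarrow> real^'n" where
  "cmap c \<equiv> snd c"

abbreviation crange :: "('p, 'n::finite) chart \<Rightarrow> (real^'n) set" where
  "crange c \<equiv> cmap c ` cdom c"

definition in_chart :: "('p, 'n::finite) chart \<Rightarrow> ('p \<Rightarrow> 'b) \<Rightarrow> real^'n \<Rightarrow> 'b" where
  "in_chart c F = F \<circ> inv_into (cdom c) (cmap c)"

definition is_chart :: "'p topology \<Rightarrow> ('p, 'n::finite) chart \<Rightarrow> bool" where
  "is_chart \<Sigma> c \<longleftrightarrow>
     openin \<Sigma> (cdom c) \<and> open (crange c) \<and>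
     homeomorphic_map (subtopology \<Sigma> (cdom c)) (top_of_set (crange c)) (cmap c)"

definition Ck_manifold :: "nat \<Rightarrow> 'p topology \<Rightarrow> ('p, 'n::finite) chart set \<Rightarrow> bool" where
  "Ck_manifold k \<Sigma> A \<longleftrightarrow>
     Hausdorff_space \<Sigma> \<and> second_countable \<Sigma> \<and>
     (\<forall>c\<in>A. is_chart \<Sigma> c) \<and> topspace \<Sigma> = (\<Union>c\<in>A. cdom c) \<and>
     (\<forall>c\<in>A. \<forall>d\<in>A. Ck_on k (cmap c ` (cdom c \<inter> cdom d)) (in_chart c (cmap d)))"

definition Ck_map :: "nat \<Rightarrow> ('p, 'n::finite) chart set \<Rightarrow> ('p \<Rightarrow> 'b::real_normed_vector) \<Rightarrow> bool" where
  "Ck_map k A F \<longleftrightarrow> (\<forall>c\<in>A. Ck_on k (crange c) (in_chart c F))"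

definition compact_support :: "'p topology \<Rightarrow> ('p \<Rightarrow> real) \<Rightarrow> bool" where
  "compact_support \<Sigma> f \<longleftrightarrow> compactin \<Sigma> (\<Sigma> closure_of {p \<in> topspace \<Sigma>. f p \<noteq> 0})"

text \<open>\<open>F\<close> is the immersion, \<open>N\<close> the unit normal. Continuity of \<open>N\<close> is what makes the
  hypersurface oriented. The codimension is one as soon as \<open>CARD('m) = CARD('n) + 1\<close>.\<close>

definition oriented_hypersurface ::
  "nat \<Rightarrow> 'p topology \<Rightarrow> ('p, 'n::finite) chart set \<Rightarrow> ('p \<Rightarrow> real^'m) \<Rightarrow> ('p \<Rightarrow> real^'m) \<Rightarrow> bool" where
  "oriented_hypersurface k \<Sigma> A F N \<longleftrightarrow>
     Ck_manifold k \<Sigma> A \<and>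
     Ck_map k A F \<and>
     (\<forall>c\<in>A. \<forall>x\<in>crange c. inj (frechet_derivative (in_chart c F) (at x))) \<and>
     continuous_map \<Sigma> euclidean N \<and>
     (\<forall>p\<in>topspace \<Sigma>. norm (N p) = 1) \<and>
     (\<forall>c\<in>A. \<forall>p\<in>cdom c. \<forall>v. frechet_derivative (in_chart c F) (at (cmap c p)) v \<bullet> N p = 0)"

text \<open>The geometric quantities below are computed at a point \<open>p\<close> in a chart \<open>c\<close> around \<open>p\<close>,
  from the induced metric and its Levi-Civita connection. Their values do not depend on
  the choice of \<open>c\<close>.\<close>

definition metric :: "('p, 'n::finite) chart \<Rightarrow> ('p \<Rightarrow> real^'m) \<Rightarrow> real^'n \<Rightarrow> real^'n^'n" where
  "metric c F x = (\<chi> i j. partial i (in_chart c F) x \<bullet> partial j (in_chart c F) x)"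

definition inv_metric :: "('p, 'n::finite) chart \<Rightarrow> ('p \<Rightarrow> real^'m) \<Rightarrow> real^'n \<Rightarrow> real^'n^'n" where
  "inv_metric c F x = matrix_inv (metric c F x)"

text \<open>\<open>\<sigma>(\<partial>\<^sub>i, \<partial>\<^sub>j) = \<langle>\<partial>\<^sub>i \<partial>\<^sub>j F, N\<rangle>\<close>, so that the unit sphere with inner normal has \<open>\<sigma> = g\<close>
  and principal curvatures \<open>1\<close>.\<close>

definition second_fundamental_form ::
  "('p, 'n::finite) chart \<Rightarrow> ('p \<Rightarrow> real^'m) \<Rightarrow> ('p \<Rightarrow> real^'m) \<Rightarrow> 'p \<Rightarrow> real^'n^'n" where
  "second_fundamental_form c F N p =
     (\<chi> i j. partial i (partial j (in_chart c F)) (cmap c p) \<bullet> N p)"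

definition shape_operator ::
  "('p, 'n::finite) chart \<Rightarrow> ('p \<Rightarrow> real^'m) \<Rightarrow> ('p \<Rightarrow> real^'m) \<Rightarrow> 'p \<Rightarrow> real^'n^'n" where
  "shape_operator c F N p =
     inv_metric c F (cmap c p) ** second_fundamental_form c F N p"

definition principal_space ::
  "('p, 'n::finite) chart \<Rightarrow> ('p \<Rightarrow> real^'m) \<Rightarrow> ('p \<Rightarrow> real^'m) \<Rightarrow> 'p \<Rightarrow> real \<Rightarrow> (real^'n) set" where
  "principal_space c F N p \<kappa> = {u. shape_operator c F N p *v u = \<kappa> *\<^sub>R u}"

definition principal_curvatures ::
  "('p, 'n::finite) chart \<Rightarrow> ('p \<Rightarrow> real^'m) \<Rightarrow> ('p \<Rightarrow> real^'m) \<Rightarrow> 'p \<Rightarrow> real set" where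
  "principal_curvatures c F N p = {\<kappa>. principal_space c F N p \<kappa> \<noteq> {0}}"

text \<open>The multiplicity of a principal curvature is the dimension of its space of principal
  directions; the shape operator is diagonalizable, being self-adjoint for the metric.\<close>

definition mean_curvature ::
  "('p, 'n::finite) chart \<Rightarrow> ('p \<Rightarrow> real^'m) \<Rightarrow> ('p \<Rightarrow> real^'m) \<Rightarrow> 'p \<Rightarrow> real" where
  "mean_curvature c F N p =
     (\<Sum>\<kappa>\<in>principal_curvatures c F N p. real (dim (principal_space c F N p \<kappa>)) * \<kappa>)
       / real CARD('n)"

text \<open>\<open>|\<sigma>|\<^sup>2 = g\<^sup>i\<^sup>k g\<^sup>j\<^sup>l \<sigma>\<^sub>i\<^sub>j \<sigma>\<^sub>k\<^sub>l\<close>\<close>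

definition sff_norm_sq ::
  "('p, 'n::finite) chart \<Rightarrow> ('p \<Rightarrow> real^'m) \<Rightarrow> ('p \<Rightarrow> real^'m) \<Rightarrow> 'p \<Rightarrow> real" where
  "sff_norm_sq c F N p =
     (let G = inv_metric c F (cmap c p); h = second_fundamental_form c F N p
      in \<Sum>i\<in>UNIV. \<Sum>j\<in>UNIV. \<Sum>k\<in>UNIV. \<Sum>l\<in>UNIV.
           G $ i $ k * G $ j $ l * h $ i $ j * h $ k $ l)"

text \<open>\<open>g\<^sup>i\<^sup>j \<partial>\<^sub>j f \<partial>\<^sub>i F\<close>, the gradient as a vector of the ambient space.\<close>

definition gradient ::
  "('p, 'n::finite) chart \<Rightarrow> ('p \<Rightarrow> real^'m) \<Rightarrow> ('p \<Rightarrow> real) \<Rightarrow> 'p \<Rightarrow> real^'m" where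
  "gradient c F f p =
     (let x = cmap c p
      in \<Sum>i\<in>UNIV. \<Sum>j\<in>UNIV.
           (inv_metric c F x $ i $ j * partial j (in_chart c f) x) *\<^sub>R partial i (in_chart c F) x)"

text \<open>\<open>\<Gamma>\<^sup>k\<^sub>i\<^sub>j = g\<^sup>k\<^sup>l (\<partial>\<^sub>i g\<^sub>j\<^sub>l + \<partial>\<^sub>j g\<^sub>i\<^sub>l - \<partial>\<^sub>l g\<^sub>i\<^sub>j) / 2\<close>\<close>

definition christoffel ::
  "('p, 'n::finite) chart \<Rightarrow> ('p \<Rightarrow> real^'m) \<Rightarrow> real^'n \<Rightarrow> 'n \<Rightarrow> 'n \<Rightarrow> 'n \<Rightarrow> real" where
  "christoffel c F x k i j =
     (\<Sum>l\<in>UNIV. inv_metric c F x $ k $ l *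
        (partial i (\<lambda>y. metric c F y $ j $ l) x + partial j (\<lambda>y. metric c F y $ i $ l) x
          - partial l (\<lambda>y. metric c F y $ i $ j) x)) / 2"

definition hessian ::
  "('p, 'n::finite) chart \<Rightarrow> ('p \<Rightarrow> real^'m) \<Rightarrow> ('p \<Rightarrow> real) \<Rightarrow> 'p \<Rightarrow> real^'n^'n" where
  "hessian c F f p =
     (let x = cmap c p
      in \<chi> i j. partial i (partial j (in_chart c f)) x
           - (\<Sum>k\<in>UNIV. christoffel c F x k i j * partial k (in_chart c f) x))"

definition laplacian ::
  "('p, 'n::finite) chart \<Rightarrow> ('p \<Rightarrow> real^'m) \<Rightarrow> ('p \<Rightarrow> real) \<Rightarrow> 'p \<Rightarrow> real" where
  "laplacian c F f p =
     (\<Sum>i\<in>UNIV. \<Sum>j\<in>UNIV. inv_metric c F (cmap c p) $ i $ j * hessian c F f p $ i $ j)"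

text \<open>A function on the sphere is a function on the ambient space of which only the values on
  the sphere matter: the derivative is taken within the sphere. A derivative within the
  sphere is determined on the tangent space \<open>\<xi>\<^sup>\<bottom>\<close> only, and the gradient is the tangent
  vector representing it.\<close>

definition is_sphere_gradient :: "(real^'m \<Rightarrow> real) \<Rightarrow> real^'m \<Rightarrow> real^'m \<Rightarrow> bool" where
  "is_sphere_gradient \<phi> \<xi> v \<longleftrightarrow>
     v \<bullet> \<xi> = 0 \<and> (\<phi> has_derivative (\<lambda>w. v \<bullet> w)) (at \<xi> within sphere 0 1)"

definition sphere_gradient :: "(real^'m \<Rightarrow> real) \<Rightarrow> real^'m \<Rightarrow> real^'m" where
  "sphere_gradient \<phi> \<xi> = (THE v. is_sphere_gradient \<phi> \<xi> v)"

definition C1_on_sphere :: "(real^'m \<Rightarrow> real) \<Rightarrow> bool" where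
  "C1_on_sphere \<phi> \<longleftrightarrow>
     (\<exists>G. continuous_on (sphere 0 1) G \<and> (\<forall>\<xi>\<in>sphere 0 1. is_sphere_gradient \<phi> \<xi> (G \<xi>)))"

text \<open>The class is C 3 so that the unit normal, hence also the normal variations of the
  hypersurface by C 2 functions, are of class C 2.\<close>

definition prescribed_hypersurface ::
  "(real^'m \<Rightarrow> real) \<Rightarrow> 'p topology \<Rightarrow> ('p, 'n::finite) chart set \<Rightarrow>
     ('p \<Rightarrow> real^'m) \<Rightarrow> ('p \<Rightarrow> real^'m) \<Rightarrow> bool" where
  "prescribed_hypersurface \<phi> \<Sigma> A F N \<longleftrightarrow>
     oriented_hypersurface 3 \<Sigma> A F N \<and>
     (\<forall>c\<in>A. \<forall>p\<in>cdom c. mean_curvature c F N p = \<phi> (N p))"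

definition normal_variation ::
  "('p \<Rightarrow> real^'m) \<Rightarrow> ('p \<Rightarrow> real^'m) \<Rightarrow> ('p \<Rightarrow> real) \<Rightarrow> real \<Rightarrow> 'p \<Rightarrow> real^'m" where
  "normal_variation F N f t p = F p + (t * f p) *\<^sub>R N p"

definition unit_normal_family ::
  "'p topology \<Rightarrow> ('p, 'n::finite) chart set \<Rightarrow> (real \<Rightarrow> 'p \<Rightarrow> real^'m) \<Rightarrow> ('p \<Rightarrow> real^'m) \<Rightarrow>
     real \<Rightarrow> (real \<Rightarrow> 'p \<Rightarrow> real^'m) \<Rightarrow> bool" where
  "unit_normal_family \<Sigma> A V N \<epsilon> \<nu> \<longleftrightarrow>
     (\<forall>t\<in>{-\<epsilon><..<\<epsilon>}. oriented_hypersurface 2 \<Sigma> A (V t) (\<nu> t)) \<and>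
     (\<forall>p\<in>topspace \<Sigma>. continuous_on {-\<epsilon><..<\<epsilon>} (\<lambda>t. \<nu> t p) \<and> \<nu> 0 p = N p)"

end

theory Submission
  imports Defs
begin

text \<open>
  In a chart everything happens at one point \<open>x\<close>. Write \<open>a\<^sub>i = \<partial>\<^sub>i \<psi>\<close>, \<open>G\<close> for the inverse of the
  Gram matrix of the \<open>a\<^sub>i\<close>, \<open>h\<close> for the second fundamental form and \<open>\<phi> = f \<eta>\<close>. The variation
  \<open>\<psi> + t \<phi>\<close> is affine in \<open>t\<close>, hence so are its first and second partial derivatives. What has to be
  differentiated with care are the inverse metric and the unit normal.

  The mean curvature is defined through eigenvalues and their multiplicities. A spectral theorem
  for the shape operator, which is self-adjoint for the induced metric, turns it into a trace:
  \<open>n H(t) = tr (G\<^sub>t h\<^sub>t)\<close> (lemmas \<open>self_adjoint_eigenbasis\<close>, \<open>sum_eigenvalues_eq_trace\<close>,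
  \<open>mean_curvature_eq_trace\<close>). This can be differentiated entry by entry.

  Orthogonality to the tangent space determines the unit normal up to sign, so a continuous family
  of unit normals is locally \<open>w / |w|\<close>, where \<open>w\<close> is a fixed vector minus its tangential part. That formula
  makes the normal of a hypersurface of class \<open>C\<^sup>3\<close> a map of class \<open>C\<^sup>2\<close> (\<open>unit_normal_Ck\<close>), and it
  gives \<open>\<nu>' = - \<nabla>f\<close> at \<open>t = 0\<close> (\<open>unit_normal_has_derivative\<close>). Differentiating the identities
  \<open>\<langle>a\<^sub>j, \<eta>\<rangle> = 0\<close>, \<open>|\<eta>|\<^sup>2 = 1\<close> and \<open>\<langle>\<partial>\<^sub>j \<phi>, \<eta>\<rangle> = \<partial>\<^sub>j f\<close> yields \<open>g' = - 2 f h\<close> and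
  \<open>h'\<^sub>i\<^sub>j = (Hess f)\<^sub>i\<^sub>j - f (h G h)\<^sub>i\<^sub>j\<close>. Hence
  \<open>n H'(0) = tr (G Hess f) - f tr (G h G h) + 2 f tr (G h G h) = \<Delta>f + |\<sigma>|\<^sup>2 f\<close>
  (\<open>first_variation\<close>). The chain rule within the sphere gives
  \<open>(\<H>(\<eta>\<^sup>t))' = - \<langle>\<nabla>\<^sub>\<S>\<H>, \<nabla>f\<rangle>\<close>, and the difference of the two is the claim (\<open>jacobi_operator\<close>).

  For the existence of the family of normals, let \<open>t\<close> be so small that no nonzero tangent vector of
  the varied hypersurface is a multiple of \<open>\<eta>\<close>. This condition is open in \<open>(p, t)\<close>, holds for
  \<open>t = 0\<close> and holds for all \<open>t\<close> off the support of \<open>f\<close>; compactness of the support makes it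
  uniform (\<open>uniformly_transversal\<close>). It gives both the immersion property and a unit normal on the
  side of \<open>\<eta>\<close>.
\<close>

section \<open>Frames, Gram matrices and the normal direction\<close>

lemma matrix_inv_mult:
  fixes A :: "real^'n^'n"
  assumes "det A \<noteq> 0"
  shows "A ** matrix_inv A = mat 1" "matrix_inv A ** A = mat 1"
proof -
  have "\<exists>B. A ** B = mat 1 \<and> B ** A = mat 1"
    using assms unfolding invertible_det_nz[symmetric] invertible_def .
  then have "A ** matrix_inv A = mat 1 \<and> matrix_inv A ** A = mat 1"
    unfolding matrix_inv_def by (rule someI_ex)
  then show "A ** matrix_inv A = mat 1" "matrix_inv A ** A = mat 1" by auto
qed

text \<open>Cramer's rule. It shows that the entries of the inverse depend on those of the matrix as
  smoothly as quotients of determinants do.\<close>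

lemma matrix_inv_entry:
  fixes A :: "real^'n^'n"
  assumes "det A \<noteq> 0"
  shows "matrix_inv A $ k $ j =
    det (\<chi> i l. if l = k then (if i = j then 1 else 0) else A $ i $ l) / det A"
proof -
  have "A *v (matrix_inv A *v axis j 1) = axis j 1"
    by (simp add: matrix_vector_mul_assoc matrix_inv_mult assms)
  then have "matrix_inv A *v axis j 1
      = (\<chi> k. det (\<chi> i l. if l = k then axis j 1 $ i else A $ i $ l) / det A)"
    using cramer[OF assms] by blast
  moreover have "(matrix_inv A *v axis j 1) $ k = matrix_inv A $ k $ j"
    by (simp add: matrix_vector_mult_basis column_def)
  ultimately show ?thesis
    by (simp add: axis_def cong: if_cong)
qed

lemma matrix_inv_symmetric:
  fixes A :: "real^'n^'n"
  assumes "det A \<noteq> 0" "transpose A = A"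
  shows "matrix_inv A $ i $ j = matrix_inv A $ j $ i"
proof -
  let ?B = "matrix_inv A"
  have "transpose (A ** ?B) = transpose (mat 1)" "transpose (?B ** A) = transpose (mat 1)"
    by (simp_all add: matrix_inv_mult assms)
  then have "transpose ?B ** A = mat 1"
    by (simp add: matrix_transpose_mul assms(2) transpose_mat)
  then have "transpose ?B ** (A ** ?B) = ?B"
    by (simp add: matrix_mul_assoc)
  then have "transpose ?B = ?B"
    by (simp add: matrix_inv_mult assms)
  then have "transpose ?B $ j $ i = ?B $ j $ i" by simp
  then show ?thesis by (simp add: transpose_def)
qed

text \<open>Linear independence of the indexed family, phrased so that it applies directly to the
  partial derivatives of a map: it says that the derivative is injective.\<close>

definition frame :: "('n::finite \<Rightarrow> 'a::real_vector) \<Rightarrow> bool" where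
  "frame a \<longleftrightarrow> (\<forall>v. (\<Sum>i\<in>UNIV. v $ i *\<^sub>R a i) = 0 \<longrightarrow> v = 0)"

definition gram :: "('n::finite \<Rightarrow> 'a::real_inner) \<Rightarrow> real^'n^'n" where
  "gram a = (\<chi> i j. a i \<bullet> a j)"

lemma gram_quadratic_form:
  "v \<bullet> (gram a *v v) = (norm (\<Sum>i\<in>UNIV. v $ i *\<^sub>R a i))\<^sup>2"
  unfolding power2_norm_eq_inner
  by (subst inner_commute)
    (simp add: gram_def inner_vec_def matrix_vector_mult_def inner_sum_left inner_sum_right
      sum_distrib_left inner_commute ac_simps)

lemma transpose_gram: "transpose (gram a) = gram a"
  by (simp add: transpose_def gram_def vec_eq_iff inner_commute)

lemma det_gram:
  assumes "frame a"
  shows "det (gram a) \<noteq> 0"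
proof -
  have "v = 0" if "gram a *v v = 0" for v
  proof -
    have "v \<bullet> (gram a *v v) = 0" using that by simp
    then have "(\<Sum>i\<in>UNIV. v $ i *\<^sub>R a i) = 0" by (simp add: gram_quadratic_form)
    then show ?thesis using assms unfolding frame_def by blast
  qed
  then have "\<exists>B. B ** gram a = mat 1" by (simp add: matrix_left_invertible_ker)
  then show ?thesis
    by (simp add: invertible_det_nz[symmetric] invertible_left_inverse)
qed

lemma gram_inverse_sum:
  assumes "frame a"
  shows "(\<Sum>i\<in>UNIV. (a k \<bullet> a i) * matrix_inv (gram a) $ i $ j) = (if k = j then 1 else 0)"
proof -
  have "(gram a ** matrix_inv (gram a)) $ k $ j = (mat 1 :: real^'a^'a) $ k $ j"
    by (simp add: matrix_inv_mult det_gram assms)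
  then show ?thesis by (simp add: matrix_matrix_mult_def gram_def mat_def)
qed

definition tangent_part :: "('n::finite \<Rightarrow> 'a::real_inner) \<Rightarrow> 'a \<Rightarrow> 'a" where
  "tangent_part a z =
    (\<Sum>i\<in>UNIV. \<Sum>j\<in>UNIV. (matrix_inv (gram a) $ i $ j * (z \<bullet> a j)) *\<^sub>R a i)"

text \<open>The tangential part has the same inner products with the frame as the vector itself: it
  is the orthogonal projection onto the span of the frame.\<close>

lemma tangent_part_inner:
  assumes "frame a"
  shows "tangent_part a z \<bullet> a k = z \<bullet> a k"
proof -
  have "tangent_part a z \<bullet> a k
      = (\<Sum>i\<in>UNIV. \<Sum>j\<in>UNIV. (z \<bullet> a j) * ((a k \<bullet> a i) * matrix_inv (gram a) $ i $ j))"
    by (simp add: tangent_part_def inner_sum_left inner_commute[of "a k"] ac_simps)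
  also have "\<dots> = (\<Sum>j\<in>UNIV. (z \<bullet> a j) * (\<Sum>i\<in>UNIV. (a k \<bullet> a i) * matrix_inv (gram a) $ i $ j))"
    by (subst sum.swap) (simp add: sum_distrib_left)
  also have "\<dots> = z \<bullet> a k"
    by (simp add: gram_inverse_sum assms if_distrib cong: if_cong)
  finally show ?thesis .
qed

lemma tangent_part_in_span:
  "\<exists>v. tangent_part a z = (\<Sum>i\<in>UNIV. v $ i *\<^sub>R a i)"
  by (rule exI[of _ "\<chi> i. \<Sum>j\<in>UNIV. matrix_inv (gram a) $ i $ j * (z \<bullet> a j)"])
    (simp add: tangent_part_def scaleR_sum_left)

text \<open>In codimension one a frame and a unit normal span the whole space, by a dimension count.
  This is the only place where the codimension enters.\<close>

lemma normal_expansion: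
  fixes a :: "'n::finite \<Rightarrow> real^'m"
  assumes "CARD('m) = CARD('n) + 1" "frame a" "\<And>i. a i \<bullet> N = 0" "norm N = 1"
  shows "z = tangent_part a z + (z \<bullet> N) *\<^sub>R N"
proof -
  have NN: "N \<bullet> N = 1" using assms(4) by (simp add: dot_square_norm)
  \<comment> \<open>Surjective because it is injective between spaces of the same dimension.\<close>
  define \<Phi> :: "(real^'n) \<times> real \<Rightarrow> real^'m"
    where "\<Phi> = (\<lambda>(v, s). (\<Sum>i\<in>UNIV. v $ i *\<^sub>R a i) + s *\<^sub>R N)"
  have lin: "linear \<Phi>"
    unfolding \<Phi>_def
    by (rule linearI)
      (auto simp: scaleR_add_left sum.distrib scaleR_add_right scaleR_sum_right)
  have "x = 0" if "\<Phi> x = 0" for x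
  proof -
    obtain v s where x: "x = (v, s)" by (cases x)
    have "\<Phi> x \<bullet> N = s"
      by (simp add: x \<Phi>_def inner_add_left inner_sum_left assms(3) NN)
    then have "s = 0" using that by simp
    moreover from this have "v = 0"
      using that assms(2) by (simp add: x \<Phi>_def frame_def)
    ultimately show ?thesis by (simp add: x zero_prod_def)
  qed
  then have inj: "inj \<Phi>" using lin by (simp add: linear_injective_0)
  have "dim (range \<Phi>) = dim (UNIV :: ((real^'n) \<times> real) set)"
    using dim_image_eq[OF lin, of UNIV] inj by simp
  then have "dim (range \<Phi>) = DIM(real^'m)" using assms(1) by simp
  then have "span (range \<Phi>) = UNIV" using dim_eq_full[of "range \<Phi>"] by blast
  then have surj: "range \<Phi> = UNIV"
    using linear_subspace_image[OF lin subspace_UNIV] by (metis span_eq_iff)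
  define u where "u = z - tangent_part a z - (z \<bullet> N) *\<^sub>R N"
  have "tangent_part a z \<bullet> N = 0"
    by (simp add: tangent_part_def inner_sum_left assms(3))
  then have uN: "u \<bullet> N = 0" by (simp add: u_def inner_diff_left NN)
  have ua: "u \<bullet> a k = 0" for k
    using assms(3)[of k] inner_commute[of N "a k"]
    by (simp add: u_def inner_diff_left tangent_part_inner assms(2))
  obtain v s where u: "u = \<Phi> (v, s)" using surj by (metis UNIV_I imageE surj_pair)
  have "u \<bullet> \<Phi> (v, s) = 0"
    using uN ua by (simp add: \<Phi>_def inner_add_right inner_sum_right)
  then have "u = 0" using u by simp
  then show ?thesis by (simp add: u_def algebra_simps)
qed

lemma normal_direction_unique:
  fixes a :: "'n::finite \<Rightarrow> real^'m"
  assumes "CARD('m) = CARD('n) + 1" "frame a" "\<And>i. a i \<bullet> N = 0" "norm N = 1" "\<And>i. a i \<bullet> z = 0"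
  shows "z = (z \<bullet> N) *\<^sub>R N"
proof -
  have "tangent_part a z = 0"
    using assms(5) by (simp add: tangent_part_def inner_commute)
  then show ?thesis using normal_expansion[OF assms(1-4), of z] by simp
qed

lemma inner_normal_expansion:
  fixes a :: "'n::finite \<Rightarrow> real^'m"
  assumes "CARD('m) = CARD('n) + 1" "frame a" "\<And>i. a i \<bullet> N = 0" "norm N = 1"
  shows "y \<bullet> z = (\<Sum>i\<in>UNIV. \<Sum>j\<in>UNIV. matrix_inv (gram a) $ i $ j * (y \<bullet> a i) * (z \<bullet> a j))
    + (y \<bullet> N) * (z \<bullet> N)"
proof -
  have "y \<bullet> z = y \<bullet> (tangent_part a z + (z \<bullet> N) *\<^sub>R N)"
    using normal_expansion[OF assms, of z] by simp
  then show ?thesis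
    by (simp add: inner_add_right tangent_part_def inner_sum_right ac_simps)
qed

section \<open>The spectral theorem and the trace\<close>

lemma nonneg_quadratic_linear_zero:
  fixes \<beta> c :: real
  assumes "\<And>s. 0 \<le> 2 * s * \<beta> + s\<^sup>2 * c"
  shows "\<beta> = 0"
proof (rule ccontr)
  assume "\<beta> \<noteq> 0"
  define C where "C = \<bar>c\<bar> + 1"
  have C: "C > 0" "c < C" by (auto simp: C_def)
  have "0 \<le> 2 * (- \<beta> / C) * \<beta> + (- \<beta> / C)\<^sup>2 * c" by (rule assms)
  also have "\<dots> = (\<beta>\<^sup>2 / C\<^sup>2) * (c - 2 * C)"
    using C by (simp add: power2_eq_square field_simps)
  also have "\<dots> < 0"
    using C \<open>\<beta> \<noteq> 0\<close> by (intro mult_pos_neg) auto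
  finally show False by simp
qed

text \<open>The maximum of the Rayleigh quotient on an invariant subspace is attained at an
  eigenvector. With maximal value \<open>\<mu>\<close> at \<open>u\<close>, the form \<open>\<mu>
  \<langle>v, G v\<rangle> - \<langle>v, G S v\<rangle>\<close> is nonnegative and vanishes at
  \<open>u\<close>; along the line through \<open>u\<close> in the direction \<open>r = \<mu> u - S
  u\<close> its linear coefficient is \<open>2 \<langle>r, G r\<rangle>\<close>, which must be
  zero.\<close>

lemma Rayleigh_eigenvector:
  fixes G S :: "real^'n^'n"
  assumes symG: "\<And>u v. u \<bullet> (G *v v) = v \<bullet> (G *v u)"
    and pos: "\<And>u. u \<noteq> 0 \<Longrightarrow> 0 < u \<bullet> (G *v u)"
    and selfadj: "\<And>u v. u \<bullet> (G *v (S *v v)) = v \<bullet> (G *v (S *v u))"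
    and W: "subspace W" "\<And>u. u \<in> W \<Longrightarrow> S *v u \<in> W" "W \<noteq> {0}"
  obtains u \<mu> where "u \<in> W" "u \<noteq> 0" "S *v u = \<mu> *\<^sub>R u"
proof -
  define q where "q u = (u \<bullet> (G *v (S *v u))) / (u \<bullet> (G *v u))" for u
  have "compact (W \<inter> sphere 0 1)"
    using W(1) by (intro closed_Int_compact closed_subspace) auto
  moreover obtain w where "w \<in> W" "w \<noteq> 0" using W(1,3) subspace_0 by blast
  then have "w /\<^sub>R norm w \<in> W \<inter> sphere 0 1"
    using W(1) by (simp add: subspace_scale)
  then have "W \<inter> sphere 0 1 \<noteq> {}" by blast
  moreover have "u \<bullet> (G *v u) \<noteq> 0" if "u \<in> W \<inter> sphere 0 1" for u
  proof -
    have "u \<noteq> 0" using that by auto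
    then show ?thesis using pos[of u] by simp
  qed
  then have "continuous_on (W \<inter> sphere 0 1) q"
    unfolding q_def
    by (intro continuous_intros matrix_vector_mult_linear_continuous_on
        continuous_on_compose2[OF matrix_vector_mult_linear_continuous_on]) auto
  ultimately obtain u where u: "u \<in> W \<inter> sphere 0 1"
    and max: "\<And>v. v \<in> W \<inter> sphere 0 1 \<Longrightarrow> q v \<le> q u"
    using continuous_attains_sup[of "W \<inter> sphere 0 1" q] by blast
  define \<mu> where "\<mu> = q u"
  have u0: "u \<noteq> 0" "u \<in> W" using u by auto
  have le: "v \<bullet> (G *v (S *v v)) \<le> \<mu> * (v \<bullet> (G *v v))" if "v \<in> W" for v
  proof (cases "v = 0")
    case False
    have "q v = q (v /\<^sub>R norm v)"
      using False by (simp add: q_def matrix_vector_mult_scaleR field_simps)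
    also have "\<dots> \<le> \<mu>"
      unfolding \<mu>_def using False that W(1) by (intro max) (simp add: subspace_scale)
    finally show ?thesis
      using pos[OF False] by (simp add: q_def field_simps)
  qed simp
  have eq: "u \<bullet> (G *v (S *v u)) = \<mu> * (u \<bullet> (G *v u))"
    using pos[OF u0(1)] by (simp add: \<mu>_def q_def)
  \<comment> \<open>The defect of the eigenvalue equation, itself a vector of the invariant subspace.\<close>
  define r where "r = \<mu> *\<^sub>R u - S *v u"
  have rW: "r \<in> W"
    unfolding r_def using W u0 by (intro subspace_diff subspace_scale) auto
  have "0 \<le> 2 * s * (r \<bullet> (G *v r)) + s\<^sup>2 * (\<mu> * (r \<bullet> (G *v r)) - r \<bullet> (G *v (S *v r)))" for s
  proof -
    have "u + s *\<^sub>R r \<in> W" using rW u0 W(1) by (intro subspace_add subspace_scale)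
    from le[OF this] have "0 \<le> \<mu> * ((u + s *\<^sub>R r) \<bullet> (G *v (u + s *\<^sub>R r)))
        - (u + s *\<^sub>R r) \<bullet> (G *v (S *v (u + s *\<^sub>R r)))" by simp
    also have "\<dots> = 2 * s * (\<mu> * (r \<bullet> (G *v u)) - r \<bullet> (G *v (S *v u)))
        + s\<^sup>2 * (\<mu> * (r \<bullet> (G *v r)) - r \<bullet> (G *v (S *v r)))"
      using symG[of u r] selfadj[of u r] eq
      by (simp add: matrix_vector_right_distrib matrix_vector_mult_scaleR inner_add_left
          inner_add_right power2_eq_square algebra_simps)
    also have "\<mu> * (r \<bullet> (G *v u)) - r \<bullet> (G *v (S *v u)) = r \<bullet> (G *v r)"
      by (simp add: r_def matrix_vector_mult_diff_distrib matrix_vector_mult_scaleR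
          inner_diff_right)
    finally show ?thesis .
  qed
  then have "r \<bullet> (G *v r) = 0" by (rule nonneg_quadratic_linear_zero)
  then have "r = 0" using pos[of r] by force
  then have "S *v u = \<mu> *\<^sub>R u" by (simp add: r_def)
  with u0 that show ?thesis by blast
qed

text \<open>Split off an eigenvector and pass to its orthogonal complement for the inner product
  \<open>\<langle>u, G v\<rangle>\<close>, which is again invariant because \<open>S\<close> is
  self-adjoint for this inner product.\<close>

lemma self_adjoint_eigenbasis:
  fixes G S :: "real^'n^'n"
  assumes symG: "\<And>u v. u \<bullet> (G *v v) = v \<bullet> (G *v u)"
    and pos: "\<And>u. u \<noteq> 0 \<Longrightarrow> 0 < u \<bullet> (G *v u)"
    and selfadj: "\<And>u v. u \<bullet> (G *v (S *v v)) = v \<bullet> (G *v (S *v u))"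
    and "subspace W" "\<And>u. u \<in> W \<Longrightarrow> S *v u \<in> W"
  shows "\<exists>B. independent B \<and> span B = W \<and> (\<forall>b\<in>B. \<exists>\<mu>. S *v b = \<mu> *\<^sub>R b)"
  using assms(4,5)
proof (induction "dim W" arbitrary: W rule: less_induct)
  case less
  show ?case
  proof (cases "W = {0}")
    case True
    then show ?thesis
      by (intro exI[of _ "{}"]) (simp add: independent_empty)
  next
    case False
    obtain u \<mu> where u: "u \<in> W" "u \<noteq> 0" "S *v u = \<mu> *\<^sub>R u"
      using Rayleigh_eigenvector[OF symG pos selfadj less.prems False] by metis
    define W' where "W' = {v \<in> W. v \<bullet> (G *v u) = 0}"
    have sub: "subspace W'"
      unfolding subspace_def W'_def using less.prems(1)
      by (auto simp: inner_add_left subspace_0 subspace_add subspace_scale)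
    have "u \<notin> W'" using pos[OF u(2)] by (simp add: W'_def)
    have "W' \<subset> W" using u(1) \<open>u \<notin> W'\<close> by (auto simp: W'_def)
    then have "dim W' < dim W"
      using sub less.prems(1) by (metis dim_psubset span_eq_iff)
    moreover have "S *v v \<in> W'" if "v \<in> W'" for v
    proof -
      have "(S *v v) \<bullet> (G *v u) = u \<bullet> (G *v (S *v v))" by (rule symG)
      also have "\<dots> = v \<bullet> (G *v (S *v u))" by (rule selfadj)
      also have "\<dots> = 0" using that u(3) by (simp add: W'_def matrix_vector_mult_scaleR)
      finally show ?thesis using that less.prems(2) by (simp add: W'_def)
    qed
    ultimately obtain B where B: "independent B" "span B = W'"
        "\<forall>b\<in>B. \<exists>\<mu>. S *v b = \<mu> *\<^sub>R b"
      using less.hyps[OF _ sub] by blast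
    have "independent (insert u B)"
      using B \<open>u \<notin> W'\<close> by (simp add: independent_insertI)
    moreover have "span (insert u B) = W"
    proof
      show "span (insert u B) \<subseteq> W"
        using B(2) \<open>W' \<subset> W\<close> u(1) less.prems(1) span_superset[of B]
        by (intro span_minimal) auto
      show "W \<subseteq> span (insert u B)"
      proof
        fix w assume w: "w \<in> W"
        define c where "c = (w \<bullet> (G *v u)) / (u \<bullet> (G *v u))"
        have "w - c *\<^sub>R u \<in> W'"
          using w u less.prems(1) pos[OF u(2)]
          by (simp add: W'_def c_def inner_diff_left subspace_diff subspace_scale)
        then show "w \<in> span (insert u B)"
          using B(2) by (auto simp: span_insert)
      qed
    qed
    ultimately show ?thesis using B(3) u(3) by (intro exI[of _ "insert u B"]) auto
  qed
qed

text \<open>In a basis of eigenvectors the matrix is diagonal, and the dimension of an eigenspace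
  counts the diagonal entries with that eigenvalue. The trace does not change under the change of
  basis.\<close>

lemma sum_eigenvalues_eq_trace:
  fixes S :: "real^'n^'n"
  assumes "independent B" "span B = UNIV" "\<And>b. b \<in> B \<Longrightarrow> \<exists>\<mu>. S *v b = \<mu> *\<^sub>R b"
  defines "E \<equiv> \<lambda>\<kappa>. {u. S *v u = \<kappa> *\<^sub>R u}"
  shows "(\<Sum>\<kappa> | E \<kappa> \<noteq> {0}. real (dim (E \<kappa>)) * \<kappa>) = trace S"
proof -
  have finB: "finite B" using assms(1) by (rule independent_imp_finite)
  have "card B = CARD('n)"
    using dim_span_eq_card_independent[OF assms(1)] assms(2) by simp
  then obtain \<beta> where \<beta>: "bij_betw \<beta> (UNIV :: 'n set) B"
    using finite_same_card_bij[of "UNIV :: 'n set" B] finB by auto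
  have "\<forall>j. \<exists>\<mu>. S *v \<beta> j = \<mu> *\<^sub>R \<beta> j"
    using assms(3) \<beta> by (auto simp: bij_betw_def)
  then obtain d where d: "\<And>j. S *v \<beta> j = d j *\<^sub>R \<beta> j"
    by metis
  define P :: "real^'n^'n" where "P = (\<chi> i j. \<beta> j $ i)"
  define D :: "real^'n^'n" where "D = (\<chi> i j. if i = j then d i else 0)"
  have P: "P *v y = (\<Sum>j\<in>UNIV. y $ j *\<^sub>R \<beta> j)" for y
    by (simp add: P_def matrix_vector_mult_def vec_eq_iff mult.commute)
  have ker: "y = 0" if "P *v y = 0" for y
  proof -
    have inj: "inj \<beta>" "range \<beta> = B" using \<beta> by (auto simp: bij_betw_def)
    have "(\<Sum>b\<in>B. (y $ inv \<beta> b) *\<^sub>R b) = 0"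
      using that inj sum.reindex[OF inj(1), of "\<lambda>b. (y $ inv \<beta> b) *\<^sub>R b"]
      by (simp add: P)
    then have "\<forall>b\<in>B. y $ inv \<beta> b = 0"
      using assms(1) finB by (auto simp: independent_explicit)
    then show ?thesis using inj by (metis inv_f_f rangeI vec_eq_iff zero_index)
  qed
  then obtain Q where QP: "Q ** P = mat 1"
    using matrix_left_invertible_ker[of P] by blast
  then have PQ: "P ** Q = mat 1" by (simp add: matrix_left_right_inverse)
  have Dy: "D *v y = (\<chi> i. d i * y $ i)" for y
    by (simp add: D_def matrix_vector_mult_def if_distrib[of "\<lambda>c. c * _"] cong: if_cong)
  have SP: "S *v (P *v y) = P *v (D *v y)" for y
    by (simp add: P Dy linear_sum[OF matrix_vector_mul_linear] matrix_vector_mult_scaleR d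
        mult.commute)
  then have "S ** P = P ** D"
    by (metis matrix_eq matrix_vector_mul_assoc)
  then have "S = P ** D ** Q"
    using PQ by (metis matrix_mul_assoc matrix_mul_rid)
  then have "trace S = trace D"
    using trace_mul_sym[of "P ** D" Q] QP
    by (simp add: matrix_mul_assoc)
  then have tr: "trace S = (\<Sum>i\<in>UNIV. d i)" by (simp add: trace_def D_def)
  have E: "E \<kappa> = (*v) P ` {y. \<forall>i. i \<notin> {i. d i = \<kappa>} \<longrightarrow> y $ i = 0}" for \<kappa>
  proof -
    have mem: "P *v y \<in> E \<kappa> \<longleftrightarrow> (\<forall>i. i \<notin> {i. d i = \<kappa>} \<longrightarrow> y $ i = 0)" for y
    proof -
      have "P *v y \<in> E \<kappa> \<longleftrightarrow> P *v (D *v y - \<kappa> *\<^sub>R y) = 0"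
        by (simp add: E_def SP matrix_vector_mult_diff_distrib matrix_vector_mult_scaleR)
      also have "\<dots> \<longleftrightarrow> D *v y - \<kappa> *\<^sub>R y = 0"
        using ker[of "D *v y - \<kappa> *\<^sub>R y"] by auto
      also have "\<dots> \<longleftrightarrow> (\<forall>i. (d i - \<kappa>) * y $ i = 0)"
        by (simp add: vec_eq_iff Dy algebra_simps)
      finally show ?thesis by auto
    qed
    have "P *v (Q *v u) = u" for u
      by (simp add: matrix_vector_mul_assoc PQ)
    then have "E \<kappa> = (*v) P ` {y. P *v y \<in> E \<kappa>}"
      by (auto intro!: image_eqI[of _ _ "Q *v _"])
    then show ?thesis by (simp only: mem)
  qed
  have "inj ((*v) P)"
    unfolding linear_injective_0[OF matrix_vector_mul_linear] using ker by blast
  then have injP: "inj_on ((*v) P) A" for A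
    by (rule inj_on_subset) simp
  have dimE: "dim (E \<kappa>) = card {i. d i = \<kappa>}" for \<kappa>
    unfolding E
    by (subst dim_image_eq[OF matrix_vector_mul_linear injP])
      (simp only: dim_vec_eq[symmetric] dim_substandard_cart)
  have zero: "0 \<in> E \<kappa>" for \<kappa> by (simp add: E_def)
  have "E \<kappa> \<noteq> {0} \<longleftrightarrow> \<kappa> \<in> range d" for \<kappa>
  proof -
    have "E \<kappa> = {0} \<longleftrightarrow> dim (E \<kappa>) = 0"
      unfolding dim_eq_0 using zero[of \<kappa>] by blast
    also have "\<dots> \<longleftrightarrow> {i. d i = \<kappa>} = {}"
      unfolding dimE by (rule card_0_eq) simp
    finally show ?thesis by blast
  qed
  then have "{\<kappa>. E \<kappa> \<noteq> {0}} = range d" by blast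
  then have "(\<Sum>\<kappa> | E \<kappa> \<noteq> {0}. real (dim (E \<kappa>)) * \<kappa>)
      = (\<Sum>\<kappa>\<in>range d. \<Sum>i | i \<in> UNIV \<and> d i = \<kappa>. d i)"
    by (simp add: dimE)
  also have "\<dots> = trace S"
    unfolding tr by (rule sum.image_gen[symmetric]) simp
  finally show ?thesis .
qed

section \<open>Functions of class Ck\<close>

lemma Ck_on_SucD:
  assumes "Ck_on (Suc k) S f"
  shows "x \<in> S \<Longrightarrow> (f has_derivative frechet_derivative f (at x)) (at x)"
    and "Ck_on k S (\<lambda>x. frechet_derivative f (at x) v)"
  using assms by (auto simp: frechet_derivative_works[symmetric])

lemma Ck_on_continuous: "Ck_on k S f \<Longrightarrow> continuous_on S f"
  by (cases k) (auto intro!: continuous_at_imp_continuous_on differentiable_imp_continuous_within)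

text \<open>Openness of the domain is essential: only then do the values on it determine the
  derivatives.\<close>

lemma Ck_on_cong:
  assumes "open S" "\<And>x. x \<in> S \<Longrightarrow> f x = g x" "Ck_on k S f"
  shows "Ck_on k S g"
  using assms(2,3)
proof (induction k arbitrary: f g)
  case 0
  then show ?case by (simp cong: continuous_on_cong)
next
  case (Suc k)
  have "(g has_derivative frechet_derivative f (at x)) (at x)" if "x \<in> S" for x
    using Ck_on_SucD(1)[OF Suc.prems(2) that] assms(1) that Suc.prems(1)
    by (rule has_derivative_transform_within_open)
  then have "frechet_derivative f (at x) = frechet_derivative g (at x)" "g differentiable (at x)"
    if "x \<in> S" for x
    using that by (auto intro: frechet_derivative_at differentiableI)
  then show ?case
    using Suc.IH[OF _ Ck_on_SucD(2)[OF Suc.prems(2)]] by simp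
qed

lemma Ck_on_SucI:
  assumes "open S" "\<And>x. x \<in> S \<Longrightarrow> (f has_derivative f' x) (at x)"
    and "\<And>v. Ck_on k S (\<lambda>x. f' x v)"
  shows "Ck_on (Suc k) S f"
  using assms(2) Ck_on_cong[OF assms(1) _ assms(3)]
  by (auto simp: differentiable_def frechet_derivative_at[OF assms(2), symmetric])

lemma Ck_on_SucD_lower: "Ck_on (Suc k) S f \<Longrightarrow> Ck_on k S f"
proof (induction k arbitrary: f)
  case 0
  then show ?case using Ck_on_continuous[OF 0] by simp
next
  case (Suc k)
  have "Ck_on k S (\<lambda>x. frechet_derivative f (at x) v)" for v
    by (rule Suc.IH[OF Ck_on_SucD(2)[OF Suc.prems]])
  then show ?case using Suc.prems by simp
qed

lemma Ck_on_le: "j \<le> k \<Longrightarrow> Ck_on k S f \<Longrightarrow> Ck_on j S f"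
  by (induction k rule: dec_induct) (auto dest: Ck_on_SucD_lower simp del: Ck_on.simps)

lemma Ck_on_subset: "Ck_on k S f \<Longrightarrow> T \<subseteq> S \<Longrightarrow> Ck_on k T f"
  by (induction k arbitrary: f) (auto intro: continuous_on_subset)

text \<open>Lets regularity be proved with a formula that is valid only near the given
  point.\<close>

lemma Ck_on_locally:
  assumes "\<And>x. x \<in> S \<Longrightarrow> \<exists>U. open U \<and> x \<in> U \<and> Ck_on k U f"
  shows "Ck_on k S f"
  using assms
proof (induction k arbitrary: f)
  case 0
  have "isCont f x" if "x \<in> S" for x
    using 0[OF that] by (auto simp: continuous_on_eq_continuous_at)
  then show ?case by (simp add: continuous_at_imp_continuous_on)
next
  case (Suc k)
  show ?case
    unfolding Ck_on.simps
  proof (intro conjI ballI allI)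
    show "f differentiable (at x)" if "x \<in> S" for x
      using Suc.prems[OF that] by auto
    show "Ck_on k S (\<lambda>x. frechet_derivative f (at x) v)" for v
    proof (rule Suc.IH)
      fix x assume "x \<in> S"
      then obtain U where "open U" "x \<in> U" "Ck_on (Suc k) U f" using Suc.prems by blast
      then show "\<exists>U. open U \<and> x \<in> U \<and> Ck_on k U (\<lambda>x. frechet_derivative f (at x) v)"
        using Ck_on_SucD(2) by blast
    qed
  qed
qed

lemma Ck_on_const: "Ck_on k S (\<lambda>x. c)"
  by (induction k arbitrary: c) (auto simp: frechet_derivative_const)

lemma Ck_on_add:
  assumes "open S" "Ck_on k S f" "Ck_on k S g"
  shows "Ck_on k S (\<lambda>x. f x + g x)"
  using assms(2,3)
proof (induction k arbitrary: f g)
  case 0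
  then show ?case by (simp add: continuous_on_add)
next
  case (Suc k)
  show ?case
    by (rule Ck_on_SucI[OF assms(1) has_derivative_add[OF Ck_on_SucD(1) Ck_on_SucD(1)]])
      (use Suc in \<open>auto intro: Ck_on_SucD(2) simp del: Ck_on.simps\<close>)
qed

lemma Ck_on_sum:
  assumes "open S" "\<And>i. i \<in> I \<Longrightarrow> Ck_on k S (f i)"
  shows "Ck_on k S (\<lambda>x. \<Sum>i\<in>I. f i x)"
  using assms(2)
  by (induction I rule: infinite_finite_induct) (auto intro!: Ck_on_add Ck_on_const assms(1))

lemma Ck_on_bilinear:
  assumes "bounded_bilinear b" "open S" "Ck_on k S f" "Ck_on k S g"
  shows "Ck_on k S (\<lambda>x. b (f x) (g x))"
  using assms(3,4)
proof (induction k arbitrary: f g)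
  case 0
  then show ?case by (simp add: bounded_bilinear.continuous_on[OF assms(1)])
next
  case (Suc k)
  show ?case
  proof (rule Ck_on_SucI[OF assms(2) bounded_bilinear.FDERIV[OF assms(1) Ck_on_SucD(1) Ck_on_SucD(1)]])
    show "Ck_on k S (\<lambda>x. b (f x) (frechet_derivative g (at x) v)
        + b (frechet_derivative f (at x) v) (g x))" for v
      using Suc.prems
      by (intro Ck_on_add assms(2) Suc.IH Ck_on_SucD(2)) (auto dest: Ck_on_SucD_lower simp del: Ck_on.simps)
  qed (use Suc.prems in auto)
qed

lemmas Ck_on_mult = Ck_on_bilinear[OF bounded_bilinear_mult]
lemmas Ck_on_scaleR = Ck_on_bilinear[OF bounded_bilinear_scaleR]
lemmas Ck_on_inner = Ck_on_bilinear[OF bounded_bilinear_inner]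

lemma Ck_on_prod:
  fixes f :: "'i \<Rightarrow> real^'n \<Rightarrow> real"
  assumes "open S" "\<And>i. i \<in> I \<Longrightarrow> Ck_on k S (f i)"
  shows "Ck_on k S (\<lambda>x. \<Prod>i\<in>I. f i x)"
  using assms(2)
  by (induction I rule: infinite_finite_induct) (auto intro!: Ck_on_mult Ck_on_const assms(1))

lemma Ck_on_inverse:
  fixes u :: "real^'n \<Rightarrow> real"
  assumes "open S" "\<And>x. x \<in> S \<Longrightarrow> u x \<noteq> 0" "Ck_on k S u"
  shows "Ck_on k S (\<lambda>x. inverse (u x))"
  using assms(3)
proof (induction k)
  case 0
  then show ?case using assms(2) by (simp add: continuous_on_inverse)
next
  case (Suc k)
  then have k: "Ck_on k S u" "Ck_on k S (\<lambda>x. inverse (u x))"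
    by (auto dest: Ck_on_SucD_lower simp del: Ck_on.simps)
  show ?case
  proof (rule Ck_on_SucI[OF assms(1) Deriv.has_derivative_inverse[OF assms(2) Ck_on_SucD(1)]])
    have "Ck_on k S (\<lambda>x. - 1 * (inverse (u x) * frechet_derivative u (at x) v * inverse (u x)))" for v
      using Suc.prems k by (intro Ck_on_mult Ck_on_const assms(1) Ck_on_SucD(2)) auto
    then show "Ck_on k S (\<lambda>x. - (inverse (u x) * frechet_derivative u (at x) v * inverse (u x)))" for v
      by simp
  qed (use Suc.prems in auto)
qed

lemma Ck_on_sqrt:
  fixes u :: "real^'n \<Rightarrow> real"
  assumes "open S" "\<And>x. x \<in> S \<Longrightarrow> 0 < u x" "Ck_on k S u"
  shows "Ck_on k S (\<lambda>x. sqrt (u x))"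
  using assms(3)
proof (induction k)
  case 0
  then show ?case by (simp add: continuous_on_real_sqrt)
next
  case (Suc k)
  then have k: "Ck_on k S u" "Ck_on k S (\<lambda>x. sqrt (u x))"
    by (auto dest: Ck_on_SucD_lower simp del: Ck_on.simps)
  have nz: "sqrt (u x) \<noteq> 0" if "x \<in> S" for x using assms(2)[OF that] by simp
  show ?case
  proof (rule Ck_on_SucI[OF assms(1)])
    show "((\<lambda>x. sqrt (u x)) has_derivative
        (\<lambda>v. frechet_derivative u (at x) v * (inverse (sqrt (u x)) / 2))) (at x)" if "x \<in> S" for x
      using DERIV_real_sqrt[OF assms(2)[OF that]] Ck_on_SucD(1)[OF Suc.prems that]
      by (rule DERIV_compose_FDERIV)
    show "Ck_on k S (\<lambda>x. frechet_derivative u (at x) v * (inverse (sqrt (u x)) / 2))" for v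
      unfolding divide_inverse
      using Suc.prems k nz
      by (intro Ck_on_mult Ck_on_inverse Ck_on_const assms(1) Ck_on_SucD(2)) auto
  qed
qed

lemma Ck_on_det:
  fixes A :: "real^'k \<Rightarrow> real^'n^'n"
  assumes "open S" "\<And>i j. Ck_on k S (\<lambda>x. A x $ i $ j)"
  shows "Ck_on k S (\<lambda>x. det (A x))"
  unfolding det_def by (intro Ck_on_sum Ck_on_mult Ck_on_prod Ck_on_const assms)

lemma Ck_on_matrix_inv:
  fixes A :: "real^'k \<Rightarrow> real^'n^'n"
  assumes "open S" "\<And>i j. Ck_on k S (\<lambda>x. A x $ i $ j)" "\<And>x. x \<in> S \<Longrightarrow> det (A x) \<noteq> 0"
  shows "Ck_on k S (\<lambda>x. matrix_inv (A x) $ i $ j)"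
proof (rule Ck_on_cong[OF assms(1)])
  have "Ck_on k S (\<lambda>x. (\<chi> p q. if q = i then (if p = j then 1 else 0) else A x $ p $ q) $ p $ q)" for p q
    by (cases "q = i") (simp_all add: assms(2) Ck_on_const)
  then show "Ck_on k S (\<lambda>x. det (\<chi> p q. if q = i then (if p = j then 1 else 0) else A x $ p $ q)
      * inverse (det (A x)))"
    by (intro Ck_on_mult Ck_on_inverse Ck_on_det assms)
qed (simp add: matrix_inv_entry assms(3) divide_inverse)

lemma tendsto_det:
  fixes A :: "'a \<Rightarrow> real^'n^'n"
  assumes "\<And>i j. ((\<lambda>x. A x $ i $ j) \<longlongrightarrow> B $ i $ j) F"
  shows "((\<lambda>x. det (A x)) \<longlongrightarrow> det B) F"
  unfolding det_def by (intro tendsto_intros assms)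

lemma tendsto_matrix_inv:
  fixes A :: "'a \<Rightarrow> real^'n^'n"
  assumes "\<And>i j. ((\<lambda>x. A x $ i $ j) \<longlongrightarrow> B $ i $ j) F" "det B \<noteq> 0"
  shows "((\<lambda>x. matrix_inv (A x) $ i $ j) \<longlongrightarrow> matrix_inv B $ i $ j) F"
proof -
  let ?M = "\<lambda>C. (\<chi> p q. if q = i then (if p = j then 1 else 0) else C $ p $ q) :: real^'n^'n"
  have "((\<lambda>x. ?M (A x) $ p $ q) \<longlongrightarrow> ?M B $ p $ q) F" for p q
    by (cases "q = i") (simp_all add: assms(1))
  then have "((\<lambda>x. det (?M (A x)) / det (A x)) \<longlongrightarrow> det (?M B) / det B) F"
    by (intro tendsto_divide tendsto_det assms)
  then have lim: "((\<lambda>x. det (?M (A x)) / det (A x)) \<longlongrightarrow> matrix_inv B $ i $ j) F"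
    by (simp only: matrix_inv_entry[OF assms(2)])
  have "\<forall>\<^sub>F x in F. det (A x) \<noteq> 0"
    using tendsto_det[OF assms(1)] assms(2) by (rule tendsto_imp_eventually_ne)
  then have "\<forall>\<^sub>F x in F. det (?M (A x)) / det (A x) = matrix_inv (A x) $ i $ j"
    by eventually_elim (rule matrix_inv_entry[symmetric])
  with lim show ?thesis by (rule Lim_transform_eventually)
qed

text \<open>The difference quotient is the product of the inverse at \<open>t\<close>, the
  difference quotient of the matrix and the inverse at \<open>t0\<close>, with a minus sign; so
  continuity of the inverse is enough.\<close>

lemma matrix_inv_has_derivative:
  fixes A :: "real \<Rightarrow> real^'n^'n"
  assumes "\<And>i j. ((\<lambda>t. A t $ i $ j) has_real_derivative A' i j) (at t0)" "det (A t0) \<noteq> 0"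
  shows "((\<lambda>t. matrix_inv (A t) $ i $ j) has_real_derivative
    - (\<Sum>k\<in>UNIV. \<Sum>l\<in>UNIV. matrix_inv (A t0) $ i $ k * A' k l * matrix_inv (A t0) $ l $ j)) (at t0)"
proof -
  let ?B = "\<lambda>t. matrix_inv (A t)"
  have tends: "((\<lambda>t. A t $ i $ j) \<longlongrightarrow> A t0 $ i $ j) (at t0)" for i j
    using assms(1) DERIV_isCont isCont_def by blast
  have slope: "((\<lambda>t. (A t $ k $ l - A t0 $ k $ l) / (t - t0)) \<longlongrightarrow> A' k l) (at t0)" for k l
    using assms(1) by (simp add: has_field_derivative_iff)
  have "((\<lambda>t. - (\<Sum>k\<in>UNIV. \<Sum>l\<in>UNIV. ?B t $ i $ k * ((A t $ k $ l - A t0 $ k $ l) / (t - t0)) * ?B t0 $ l $ j))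
      \<longlongrightarrow> - (\<Sum>k\<in>UNIV. \<Sum>l\<in>UNIV. ?B t0 $ i $ k * A' k l * ?B t0 $ l $ j)) (at t0)"
    by (intro tendsto_intros tendsto_matrix_inv tends slope assms(2))
  moreover have "\<forall>\<^sub>F t in at t0. det (A t) \<noteq> 0"
    using tendsto_det[OF tends] assms(2) by (rule tendsto_imp_eventually_ne)
  then have "\<forall>\<^sub>F t in at t0.
      - (\<Sum>k\<in>UNIV. \<Sum>l\<in>UNIV. ?B t $ i $ k * ((A t $ k $ l - A t0 $ k $ l) / (t - t0)) * ?B t0 $ l $ j)
      = (?B t $ i $ j - ?B t0 $ i $ j) / (t - t0)"
  proof eventually_elim
    case (elim t)
    have ldistrib: "X ** (Y - Z) = X ** Y - X ** Z" and rdistrib: "(Y - Z) ** X = Y ** X - Z ** X"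
      for X Y Z :: "real^'n^'n"
      by (simp_all add: matrix_matrix_mult_def vec_eq_iff left_diff_distrib right_diff_distrib
          sum_subtractf)
    have "?B t ** (A t - A t0) ** ?B t0 = ?B t ** A t ** ?B t0 - ?B t ** (A t0 ** ?B t0)"
      by (simp only: ldistrib rdistrib matrix_mul_assoc)
    then have "?B t ** (A t - A t0) ** ?B t0 = ?B t0 - ?B t"
      by (simp add: matrix_inv_mult[OF elim] matrix_inv_mult[OF assms(2)])
    then have "(?B t ** (A t - A t0) ** ?B t0) $ i $ j = ?B t0 $ i $ j - ?B t $ i $ j"
      by simp
    moreover have "(?B t ** (A t - A t0) ** ?B t0) $ i $ j
        = (\<Sum>k\<in>UNIV. \<Sum>l\<in>UNIV. ?B t $ i $ k * (A t $ k $ l - A t0 $ k $ l) * ?B t0 $ l $ j)"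
      by (subst sum.swap) (simp add: matrix_matrix_mult_def sum_distrib_right)
    ultimately have "(\<Sum>k\<in>UNIV. \<Sum>l\<in>UNIV. ?B t $ i $ k * (A t $ k $ l - A t0 $ k $ l) * ?B t0 $ l $ j)
        = ?B t0 $ i $ j - ?B t $ i $ j" by simp
    then have "- (\<Sum>k\<in>UNIV. \<Sum>l\<in>UNIV. ?B t $ i $ k * (A t $ k $ l - A t0 $ k $ l) * ?B t0 $ l $ j) / (t - t0)
        = (?B t $ i $ j - ?B t0 $ i $ j) / (t - t0)" by simp
    then show ?case by (simp add: sum_divide_distrib)
  qed
  ultimately show ?thesis
    unfolding has_field_derivative_iff by (rule Lim_transform_eventually)
qed

lemma partial_eqI: "(f has_derivative f') (at x) \<Longrightarrow> partial i f x = f' (axis i 1)"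
  by (simp add: partial_def frechet_derivative_at[symmetric])

lemma frechet_derivative_partials:
  assumes "f differentiable (at x)"
  shows "frechet_derivative f (at x) v = (\<Sum>i\<in>UNIV. v $ i *\<^sub>R partial i f x)"
proof -
  have lin: "linear (frechet_derivative f (at x))"
    using assms by (rule linear_frechet_derivative)
  have "v = (\<Sum>i\<in>UNIV. v $ i *\<^sub>R axis i 1)"
    using basis_expansion[of v] by (simp add: scalar_mult_eq_scaleR)
  then have "frechet_derivative f (at x) v
      = frechet_derivative f (at x) (\<Sum>i\<in>UNIV. v $ i *\<^sub>R axis i 1)" by simp
  also have "\<dots> = (\<Sum>i\<in>UNIV. v $ i *\<^sub>R partial i f x)"
    by (simp add: linear_sum[OF lin] linear_scale[OF lin] partial_def)
  finally show ?thesis .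
qed

lemma partial_bilinear:
  assumes "bounded_bilinear b" "f differentiable (at x)" "g differentiable (at x)"
  shows "partial i (\<lambda>y. b (f y) (g y)) x = b (partial i f x) (g x) + b (f x) (partial i g x)"
  using partial_eqI[OF bounded_bilinear.FDERIV[OF assms(1)
      assms(2)[unfolded frechet_derivative_works] assms(3)[unfolded frechet_derivative_works]]]
  by (simp add: partial_def add.commute)

lemmas partial_inner = partial_bilinear[OF bounded_bilinear_inner]
lemmas partial_scaleR = partial_bilinear[OF bounded_bilinear_scaleR]

lemma partial_add:
  assumes "f differentiable (at x)" "g differentiable (at x)"
  shows "partial i (\<lambda>y. f y + g y) x = partial i f x + partial i g x"
  using partial_eqI[OF has_derivative_add[OF assms[unfolded frechet_derivative_works]]]
  by (simp add: partial_def)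

lemma partial_const [simp]: "partial i (\<lambda>y. c) x = 0"
  by (simp add: partial_def frechet_derivative_const)

lemma partial_scaleR_const:
  assumes "f differentiable (at x)"
  shows "partial i (\<lambda>y. c *\<^sub>R f y) x = c *\<^sub>R partial i f x"
  using partial_scaleR[OF _ assms, of "\<lambda>_. c"] by simp

lemma partial_cong:
  assumes "f differentiable (at x)" "open S" "x \<in> S" "\<And>y. y \<in> S \<Longrightarrow> f y = g y"
  shows "partial i f x = partial i g x"
  using frechet_derivative_transform_within_open[OF assms] by (simp add: partial_def)

lemma Ck_on_partial: "Ck_on (Suc k) S f \<Longrightarrow> Ck_on k S (partial i f)"
  unfolding partial_def[abs_def] by (rule Ck_on_SucD(2))

text \<open>Two applications of the mean value theorem, first in the direction \<open>u\<close> and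
  then in the direction \<open>v\<close>.\<close>

lemma second_difference_mean_value:
  fixes g :: "real^'n \<Rightarrow> real"
  assumes "0 < s"
    and g: "\<And>y. dist x y \<le> s * (norm u + norm v) \<Longrightarrow> g differentiable (at y)"
    and gu: "\<And>y. dist x y \<le> s * (norm u + norm v) \<Longrightarrow>
      (\<lambda>z. frechet_derivative g (at z) u) differentiable (at y)"
  obtains y where "dist x y \<le> s * (norm u + norm v)"
    and "g (x + s *\<^sub>R u + s *\<^sub>R v) - g (x + s *\<^sub>R u) - g (x + s *\<^sub>R v) + g x
      = s\<^sup>2 * frechet_derivative (\<lambda>z. frechet_derivative g (at z) u) (at y) v"
proof -
  define p where "p = (\<lambda>z. frechet_derivative g (at z) u)"
  have near: "dist x (x + r *\<^sub>R u + q *\<^sub>R v) \<le> s * (norm u + norm v)"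
    if "0 \<le> r" "r \<le> s" "0 \<le> q" "q \<le> s" for r q
  proof -
    have "dist x (x + r *\<^sub>R u + q *\<^sub>R v) = norm (x + r *\<^sub>R u + q *\<^sub>R v - x)"
      by (simp only: dist_norm norm_minus_commute)
    also have "\<dots> = norm (r *\<^sub>R u + q *\<^sub>R v)" by (simp add: add.assoc)
    also have "\<dots> \<le> r * norm u + q * norm v"
      using that norm_triangle_ineq[of "r *\<^sub>R u" "q *\<^sub>R v"] by simp
    also have "\<dots> \<le> s * norm u + s * norm v"
      using that by (intro add_mono mult_right_mono) auto
    finally show ?thesis by (simp add: algebra_simps)
  qed
  have d1: "((\<lambda>r. g (x + r *\<^sub>R u + q *\<^sub>R v)) has_real_derivative p (x + r *\<^sub>R u + q *\<^sub>R v)) (at r)"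
    if "0 \<le> r" "r \<le> s" "0 \<le> q" "q \<le> s" for r q
  proof -
    let ?y = "x + r *\<^sub>R u + q *\<^sub>R v"
    have dg: "(g has_derivative frechet_derivative g (at ?y)) (at ?y)"
      using g[OF near[OF that]] by (simp add: frechet_derivative_works)
    have "((\<lambda>r. x + r *\<^sub>R u + q *\<^sub>R v) has_derivative (\<lambda>h. h *\<^sub>R u)) (at r)"
      by (auto intro!: derivative_eq_intros)
    from has_derivative_compose[OF this dg] show ?thesis
      unfolding has_field_derivative_def p_def
      by (rule has_derivative_eq_rhs)
        (simp add: fun_eq_iff linear_scale[OF has_derivative_linear[OF dg]])
  qed
  have d2: "((\<lambda>q. p (x + r *\<^sub>R u + q *\<^sub>R v)) has_real_derivative
      frechet_derivative p (at (x + r *\<^sub>R u + q *\<^sub>R v)) v) (at q)"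
    if "0 \<le> r" "r \<le> s" "0 \<le> q" "q \<le> s" for r q
  proof -
    let ?y = "x + r *\<^sub>R u + q *\<^sub>R v"
    have dp: "(p has_derivative frechet_derivative p (at ?y)) (at ?y)"
      using gu[OF near[OF that]] by (simp add: frechet_derivative_works p_def)
    have "((\<lambda>q. x + r *\<^sub>R u + q *\<^sub>R v) has_derivative (\<lambda>h. h *\<^sub>R v)) (at q)"
      by (auto intro!: derivative_eq_intros)
    from has_derivative_compose[OF this dp] show ?thesis
      unfolding has_field_derivative_def
      by (rule has_derivative_eq_rhs)
        (simp add: fun_eq_iff linear_scale[OF has_derivative_linear[OF dp]])
  qed
  define \<phi> where "\<phi> r = g (x + r *\<^sub>R u + s *\<^sub>R v) - g (x + r *\<^sub>R u + 0 *\<^sub>R v)" for r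
  have "(\<phi> has_real_derivative p (x + r *\<^sub>R u + s *\<^sub>R v) - p (x + r *\<^sub>R u + 0 *\<^sub>R v)) (at r)"
    if "0 \<le> r" "r \<le> s" for r
    unfolding \<phi>_def using that assms(1) by (intro DERIV_diff d1) auto
  from MVT2[OF assms(1) this] obtain r where r: "0 < r" "r < s"
    and eq1: "\<phi> s - \<phi> 0 = (s - 0) * (p (x + r *\<^sub>R u + s *\<^sub>R v) - p (x + r *\<^sub>R u + 0 *\<^sub>R v))"
    by auto
  have "((\<lambda>q. p (x + r *\<^sub>R u + q *\<^sub>R v)) has_real_derivative
      frechet_derivative p (at (x + r *\<^sub>R u + q *\<^sub>R v)) v) (at q)" if "0 \<le> q" "q \<le> s" for q
    using that r by (intro d2) auto
  from MVT2[OF assms(1) this] obtain q where q: "0 < q" "q < s"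
    and eq2: "p (x + r *\<^sub>R u + s *\<^sub>R v) - p (x + r *\<^sub>R u + 0 *\<^sub>R v)
      = (s - 0) * frechet_derivative p (at (x + r *\<^sub>R u + q *\<^sub>R v)) v"
    by auto
  show thesis
  proof
    show "dist x (x + r *\<^sub>R u + q *\<^sub>R v) \<le> s * (norm u + norm v)"
      using r q by (intro near) auto
    show "g (x + s *\<^sub>R u + s *\<^sub>R v) - g (x + s *\<^sub>R u) - g (x + s *\<^sub>R v) + g x
      = s\<^sup>2 * frechet_derivative (\<lambda>z. frechet_derivative g (at z) u) (at (x + r *\<^sub>R u + q *\<^sub>R v)) v"
      using eq1 eq2 by (simp add: \<phi>_def p_def[symmetric] power2_eq_square)
  qed
qed

text \<open>The second difference is symmetric in \<open>u\<close> and \<open>v\<close>; divided by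
  \<open>s\<^sup>2\<close> it is a value, near \<open>x\<close>, of either of the two iterated
  derivatives. If these differed at \<open>x\<close>, continuity would keep them apart on a
  ball.\<close>

lemma second_derivative_symmetric:
  fixes g :: "real^'n \<Rightarrow> real"
  assumes "open U" "x \<in> U" "Ck_on 2 U g"
  shows "frechet_derivative (\<lambda>z. frechet_derivative g (at z) u) (at x) v
    = frechet_derivative (\<lambda>z. frechet_derivative g (at z) v) (at x) u"
proof (rule ccontr)
  define D where "D u v y = frechet_derivative (\<lambda>z. frechet_derivative g (at z) u) (at y) v" for u v y
  assume "\<not> ?thesis"
  then have e: "0 < \<bar>D u v x - D v u x\<bar> / 2" by (simp add: D_def)
  have cont: "continuous_on U (D u v)" for u v
    using assms(3) by (simp add: numeral_2_eq_2 D_def[abs_def])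
  have "\<forall>\<^sub>F y in nhds x. y \<in> U \<and> dist (D u v y) (D u v x) < \<bar>D u v x - D v u x\<bar> / 2
      \<and> dist (D v u y) (D v u x) < \<bar>D u v x - D v u x\<bar> / 2"
    using cont[of u v] cont[of v u] assms(1,2) e
    by (intro eventually_conj eventually_nhds_in_open tendstoD)
      (auto simp: continuous_on_eq_continuous_at isCont_def tendsto_at_iff_tendsto_nhds[symmetric])
  then obtain R where R: "R > 0" and near: "\<And>y. dist y x < R \<Longrightarrow> y \<in> U \<and>
      dist (D u v y) (D u v x) < \<bar>D u v x - D v u x\<bar> / 2
      \<and> dist (D v u y) (D v u x) < \<bar>D u v x - D v u x\<bar> / 2"
    unfolding eventually_nhds_metric by blast
  define n where "n = norm u + norm v + 1"
  define s where "s = R / (2 * n)"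
  have n: "0 < n" unfolding n_def by (simp add: add_nonneg_pos)
  have s: "0 < s" using R n by (simp add: s_def)
  have "s * (norm u + norm v) \<le> s * n" using s by (simp add: n_def)
  also have "\<dots> = R / 2" using n by (simp add: s_def)
  finally have small: "s * (norm u + norm v) < R" using R by simp
  have C2: "g differentiable (at y)" "(\<lambda>z. frechet_derivative g (at z) w) differentiable (at y)"
    if "dist x y \<le> s * (norm u + norm v)" for w y
    using assms(3) near[of y] small that by (auto simp: numeral_2_eq_2 dist_commute)
  obtain y where y: "dist x y \<le> s * (norm u + norm v)"
    "g (x + s *\<^sub>R u + s *\<^sub>R v) - g (x + s *\<^sub>R u) - g (x + s *\<^sub>R v) + g x = s\<^sup>2 * D u v y"
    using second_difference_mean_value[OF s, of x u v g] C2 unfolding D_def by blast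
  obtain z where z: "dist x z \<le> s * (norm v + norm u)"
    "g (x + s *\<^sub>R v + s *\<^sub>R u) - g (x + s *\<^sub>R v) - g (x + s *\<^sub>R u) + g x = s\<^sup>2 * D v u z"
    using second_difference_mean_value[OF s, of x v u g] C2 unfolding D_def
    by (metis add.commute)
  have "s\<^sup>2 * D u v y = s\<^sup>2 * D v u z"
    using y(2) z(2) by (simp add: algebra_simps)
  then have "D u v y = D v u z" using s by simp
  moreover have "dist y x < R" "dist z x < R"
    using y(1) z(1) small by (auto simp: dist_commute add.commute)
  then have "\<bar>D u v y - D u v x\<bar> < \<bar>D u v x - D v u x\<bar> / 2"
    "\<bar>D v u z - D v u x\<bar> < \<bar>D u v x - D v u x\<bar> / 2"
    using near by (simp_all add: dist_real_def)
  moreover have "\<bar>D u v x - D v u x\<bar> \<le> \<bar>D u v y - D u v x\<bar> + \<bar>D u v y - D v u x\<bar>"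
    by simp
  ultimately show False by simp
qed

lemma partial_inner_const:
  assumes "f differentiable (at x)"
  shows "partial i (\<lambda>y. f y \<bullet> c) x = partial i f x \<bullet> c"
  using partial_inner[OF assms, of "\<lambda>_. c"] by simp

lemma partial_commute:
  fixes f :: "real^'n \<Rightarrow> real^'m"
  assumes "open U" "x \<in> U" "Ck_on 2 U f"
  shows "partial i (partial j f) x = partial j (partial i f) x"
proof -
  have d: "f differentiable (at y)" "partial j f differentiable (at y)" if "y \<in> U" for y j
    using assms(3) that by (auto simp: numeral_2_eq_2 partial_def[abs_def])
  have comp: "partial i (partial j f) x \<bullet> c = partial i (partial j (\<lambda>y. f y \<bullet> c)) x" for i j c
  proof -
    have "partial i (partial j f) x \<bullet> c = partial i (\<lambda>y. partial j f y \<bullet> c) x"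
      by (rule partial_inner_const[symmetric]) (rule d(2)[OF assms(2)])
    also have "\<dots> = partial i (partial j (\<lambda>y. f y \<bullet> c)) x"
    proof (rule partial_cong[OF _ assms(1,2)])
      show "(\<lambda>y. partial j f y \<bullet> c) differentiable at x"
        using d(2)[OF assms(2)] by simp
      show "partial j f y \<bullet> c = partial j (\<lambda>y. f y \<bullet> c) y" if "y \<in> U" for y
        by (rule partial_inner_const[symmetric]) (rule d(1)[OF that])
    qed
    finally show ?thesis .
  qed
  have C2: "Ck_on 2 U (\<lambda>y. f y \<bullet> c)" for c
    by (rule Ck_on_inner[OF assms(1,3) Ck_on_const])
  have sym: "partial i (partial j (\<lambda>y. f y \<bullet> c)) x = partial j (partial i (\<lambda>y. f y \<bullet> c)) x" for c
    using second_derivative_symmetric[OF assms(1,2) C2, of c "axis j 1" "axis i 1"]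
    by (simp only: partial_def[abs_def])
  have "partial i (partial j f) x \<bullet> c = partial j (partial i f) x \<bullet> c" for c
    unfolding comp[of i j c] comp[of j i c] by (rule sym)
  then show ?thesis
    using vector_eq_rdot[of "partial i (partial j f) x" "partial j (partial i f) x"] by blast
qed

section \<open>Derivatives of the normal, of the trace and along the sphere\<close>

lemma trace_matrix_mult: "trace (A ** B) = (\<Sum>i\<in>UNIV. \<Sum>j\<in>UNIV. A $ i $ j * B $ j $ i)"
  by (simp add: trace_def matrix_matrix_mult_def)

text \<open>Continuity of \<open>W\<close> at the single point suffices. In the application
  \<open>W\<close> contains the inverse of a Gram matrix that depends on \<open>t\<close>.\<close>

lemma scaleR_has_vector_derivative_at_0:
  fixes W :: "real \<Rightarrow> 'a::real_normed_vector"
  assumes "isCont W 0"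
  shows "((\<lambda>t. t *\<^sub>R W t) has_vector_derivative W 0) (at 0)"
  unfolding has_vector_derivative_def has_derivative_iff_norm
proof
  show "bounded_linear (\<lambda>t. t *\<^sub>R W 0)" by (rule bounded_linear_scaleR_left)
  have "((\<lambda>t. norm (W t - W 0)) \<longlongrightarrow> 0) (at 0)"
    using assms by (simp add: isCont_def tendsto_norm_zero_iff LIM_zero_iff)
  moreover have "\<forall>\<^sub>F t in at 0. norm (W t - W 0)
      = norm (t *\<^sub>R W t - 0 *\<^sub>R W 0 - (t - 0) *\<^sub>R W 0) / norm (t - 0)"
    unfolding eventually_at_filter
    by (intro always_eventually) (simp flip: scaleR_diff_right)
  ultimately show "((\<lambda>t. norm (t *\<^sub>R W t - 0 *\<^sub>R W 0 - (t - 0) *\<^sub>R W 0) / norm (t - 0)) \<longlongrightarrow> 0) (at 0)"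
    by (rule Lim_transform_eventually)
qed

text \<open>With \<open>N\<close> the normal at \<open>t = 0\<close>, the tangential part of
  \<open>N\<close> at time \<open>t\<close> is \<open>t W(t)\<close> for a continuous
  \<open>W\<close>, because \<open>\<langle>N, a\<^sub>j + t b\<^sub>j\<rangle> = t \<langle>N,
  b\<^sub>j\<rangle>\<close>. The normal at time \<open>t\<close> is \<open>N - t W(t)\<close>,
  normalized; and \<open>W(0)\<close> is tangent, so the normalization has derivative zero.\<close>

lemma unit_normal_has_derivative:
  fixes a b :: "'n::finite \<Rightarrow> real^'m" and \<nu> :: "real \<Rightarrow> real^'m"
  assumes card: "CARD('m) = CARD('n) + 1" and "0 < \<epsilon>"
    and frame: "\<And>t. \<bar>t\<bar> < \<epsilon> \<Longrightarrow> frame (\<lambda>i. a i + t *\<^sub>R b i)"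
    and normal: "\<And>t i. \<bar>t\<bar> < \<epsilon> \<Longrightarrow> (a i + t *\<^sub>R b i) \<bullet> \<nu> t = 0"
    and unit: "\<And>t. \<bar>t\<bar> < \<epsilon> \<Longrightarrow> norm (\<nu> t) = 1"
    and cont: "isCont \<nu> 0"
  shows "(\<nu> has_vector_derivative
    - (\<Sum>i\<in>UNIV. \<Sum>j\<in>UNIV. (matrix_inv (gram a) $ i $ j * (\<nu> 0 \<bullet> b j)) *\<^sub>R a i)) (at 0)"
proof -
  define N where "N = \<nu> 0"
  have N: "norm N = 1" "N \<bullet> N = 1" "a i \<bullet> N = 0" "N \<bullet> a i = 0" for i
    using unit[of 0] normal[of 0 i] \<open>0 < \<epsilon>\<close> inner_commute[of N "a i"]
    by (simp_all add: N_def dot_square_norm)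
  define W where "W t = (\<Sum>i\<in>UNIV. \<Sum>j\<in>UNIV.
      (matrix_inv (gram (\<lambda>i. a i + t *\<^sub>R b i)) $ i $ j * (N \<bullet> b j)) *\<^sub>R (a i + t *\<^sub>R b i))" for t
  define w where "w t = N - t *\<^sub>R W t" for t
  have frame0: "frame a" using frame[of 0] \<open>0 < \<epsilon>\<close> by simp
  have "((\<lambda>t. gram (\<lambda>i. a i + t *\<^sub>R b i) $ i $ j) \<longlongrightarrow> gram (\<lambda>i. a i + 0 *\<^sub>R b i) $ i $ j) (at 0)"
    for i j unfolding gram_def vec_lambda_beta by (intro tendsto_intros)
  moreover have "det (gram (\<lambda>i. a i + 0 *\<^sub>R b i)) \<noteq> 0" using det_gram[OF frame0] by simp
  ultimately have "((\<lambda>t. matrix_inv (gram (\<lambda>i. a i + t *\<^sub>R b i)) $ i $ j)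
      \<longlongrightarrow> matrix_inv (gram (\<lambda>i. a i + 0 *\<^sub>R b i)) $ i $ j) (at 0)" for i j
    by (rule tendsto_matrix_inv)
  then have "isCont W 0"
    unfolding W_def isCont_def
    by (intro tendsto_sum tendsto_scaleR tendsto_mult tendsto_add tendsto_const tendsto_ident_at)
  then have "(w has_vector_derivative 0 - W 0) (at 0)"
    unfolding w_def
    by (intro has_vector_derivative_diff has_vector_derivative_const
        scaleR_has_vector_derivative_at_0)
  then have dw: "(w has_vector_derivative - W 0) (at 0)" by simp
  have NW: "N \<bullet> W 0 = 0" by (simp add: W_def inner_sum_right N)
  have w0: "w 0 = N" by (simp add: w_def)
  have "((\<lambda>t. N \<bullet> w t) has_vector_derivative N \<bullet> (- W 0)) (at 0)"
    by (rule bounded_linear.has_vector_derivative[OF bounded_linear_inner_right dw])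
  then have "((\<lambda>t. N \<bullet> w t) has_real_derivative 0) (at 0)"
    by (simp add: has_real_derivative_iff_has_vector_derivative NW)
  then have "((\<lambda>t. inverse (sqrt (N \<bullet> w t))) has_real_derivative 0) (at 0)"
    by (auto intro!: derivative_eq_intros simp: w0 N)
  from has_vector_derivative_scaleR[OF this dw]
  have deriv: "((\<lambda>t. inverse (sqrt (N \<bullet> w t)) *\<^sub>R w t) has_vector_derivative - W 0) (at 0)"
    by (simp add: w0 N)
  have eq: "inverse (sqrt (N \<bullet> w t)) *\<^sub>R w t = \<nu> t" if "\<bar>t\<bar> < \<epsilon>" "0 < N \<bullet> \<nu> t" for t
  proof -
    have "N = tangent_part (\<lambda>i. a i + t *\<^sub>R b i) N + (N \<bullet> \<nu> t) *\<^sub>R \<nu> t"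
      by (rule normal_expansion[OF card frame normal unit]) (use that in auto)
    also have "tangent_part (\<lambda>i. a i + t *\<^sub>R b i) N = t *\<^sub>R W t"
      by (simp add: tangent_part_def W_def scaleR_sum_right inner_add_right N ac_simps)
    finally have w: "w t = (N \<bullet> \<nu> t) *\<^sub>R \<nu> t" by (simp add: w_def algebra_simps)
    then show ?thesis using that(2) by (simp flip: power2_eq_square)
  qed
  have "(\<nu> \<longlongrightarrow> \<nu> 0) (nhds 0)"
    using cont unfolding isCont_def tendsto_at_iff_tendsto_nhds .
  then have "((\<lambda>t. N \<bullet> \<nu> t) \<longlongrightarrow> N \<bullet> \<nu> 0) (nhds 0)"
    by (intro tendsto_intros)
  then have "\<forall>\<^sub>F t in nhds 0. 0 < N \<bullet> \<nu> t"
    by (rule order_tendstoD(1)) (simp add: N flip: N_def)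
  moreover have "\<forall>\<^sub>F t in nhds 0. t \<in> {-\<epsilon><..<\<epsilon>}"
    by (rule eventually_nhds_in_open) (use \<open>0 < \<epsilon>\<close> in auto)
  ultimately have "\<forall>\<^sub>F t in nhds 0. inverse (sqrt (N \<bullet> w t)) *\<^sub>R w t = \<nu> t"
    by eventually_elim (auto intro: eq)
  then obtain S where S: "open S" "0 \<in> S"
    "\<And>t. t \<in> S \<Longrightarrow> inverse (sqrt (N \<bullet> w t)) *\<^sub>R w t = \<nu> t"
    unfolding eventually_nhds by blast
  have "(\<nu> has_vector_derivative - W 0) (at 0)"
    by (rule has_vector_derivative_transform_within_open[OF deriv S])
  then show ?thesis by (simp add: W_def N_def)
qed

lemma trace_inverse_gram_has_derivative:
  fixes a b :: "'n::finite \<Rightarrow> real^'m" and \<nu> :: "real \<Rightarrow> real^'m"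
  assumes "frame a" "(\<nu> has_vector_derivative \<nu>') (at 0)"
  defines "G \<equiv> matrix_inv (gram a)"
  shows "((\<lambda>t. trace (matrix_inv (gram (\<lambda>i. a i + t *\<^sub>R b i)) **
        (\<chi> i j. (q i j + t *\<^sub>R r i j) \<bullet> \<nu> t)))
    has_real_derivative
      (\<Sum>i\<in>UNIV. \<Sum>j\<in>UNIV. G $ i $ j * (q j i \<bullet> \<nu>' + r j i \<bullet> \<nu> 0)
        - (\<Sum>k\<in>UNIV. \<Sum>l\<in>UNIV. G $ i $ k * (a k \<bullet> b l + b k \<bullet> a l) * G $ l $ j)
          * (q j i \<bullet> \<nu> 0))) (at 0)"
proof -
  have dg: "((\<lambda>t. gram (\<lambda>i. a i + t *\<^sub>R b i) $ i $ j) has_real_derivative (a i \<bullet> b j + b i \<bullet> a j)) (at 0)" for i j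
    unfolding gram_def vec_lambda_beta has_real_derivative_iff_has_vector_derivative
    by (auto intro!: derivative_eq_intros simp: inner_add_left inner_add_right)
  have dG: "((\<lambda>t. matrix_inv (gram (\<lambda>i. a i + t *\<^sub>R b i)) $ i $ j) has_real_derivative
      - (\<Sum>k\<in>UNIV. \<Sum>l\<in>UNIV. G $ i $ k * (a k \<bullet> b l + b k \<bullet> a l) * G $ l $ j)) (at 0)" for i j
    using matrix_inv_has_derivative[OF dg] det_gram[OF assms(1)] by (simp add: G_def)
  have dh: "((\<lambda>t. (q i j + t *\<^sub>R r i j) \<bullet> \<nu> t) has_real_derivative (q i j \<bullet> \<nu>' + r i j \<bullet> \<nu> 0)) (at 0)" for i j
  proof -
    have "((\<lambda>t. q i j + t *\<^sub>R r i j) has_vector_derivative r i j) (at 0)"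
      by (auto intro!: derivative_eq_intros)
    from bounded_bilinear.has_vector_derivative[OF bounded_bilinear_inner this assms(2)]
    show ?thesis by (simp add: has_real_derivative_iff_has_vector_derivative)
  qed
  show ?thesis
    unfolding trace_matrix_mult vec_lambda_beta
    by (rule DERIV_cong, (rule DERIV_sum DERIV_mult dG dh)+)
      (simp add: G_def algebra_simps)
qed

text \<open>A great circle with prescribed initial velocity, used to test derivatives within the
  sphere.\<close>

lemma sphere_curve:
  fixes \<xi> d :: "'a::real_inner"
  assumes "norm \<xi> = 1" "norm d = 1" "d \<bullet> \<xi> = 0"
  defines "\<gamma> \<equiv> \<lambda>s. cos s *\<^sub>R \<xi> + sin s *\<^sub>R d"
  shows "\<gamma> s \<in> sphere 0 1" "(\<gamma> has_vector_derivative d) (at 0)" "\<gamma> 0 = \<xi>"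
proof -
  have "\<xi> \<bullet> \<xi> = 1" "d \<bullet> d = 1" "\<xi> \<bullet> d = 0"
    using assms(1-3) by (simp_all add: norm_eq_1 inner_commute)
  then have "\<gamma> s \<bullet> \<gamma> s = (cos s)\<^sup>2 + (sin s)\<^sup>2"
    using assms(3) by (simp add: \<gamma>_def inner_add_left inner_add_right power2_eq_square)
  then have "norm (\<gamma> s) = 1" by (simp add: norm_eq_1)
  then show "\<gamma> s \<in> sphere 0 1" by simp
  show "(\<gamma> has_vector_derivative d) (at 0)"
    unfolding \<gamma>_def by (auto intro!: derivative_eq_intros)
  show "\<gamma> 0 = \<xi>" by (simp add: \<gamma>_def)
qed

lemma sphere_derivative_along_curve:
  assumes "(\<phi> has_derivative (\<lambda>w. v \<bullet> w)) (at (\<gamma> 0) within sphere 0 1)"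
    and "(\<gamma> has_vector_derivative d) (at 0)" "open I" "0 \<in> I" "\<And>s. s \<in> I \<Longrightarrow> \<gamma> s \<in> sphere 0 1"
  shows "((\<lambda>s. \<phi> (\<gamma> s)) has_real_derivative v \<bullet> d) (at 0)"
proof -
  have d\<gamma>: "(\<gamma> has_derivative (\<lambda>h. h *\<^sub>R d)) (at 0 within I)"
    using assms(2) by (simp add: has_vector_derivative_def has_derivative_at_withinI)
  have d\<phi>: "(\<phi> has_derivative (\<lambda>w. v \<bullet> w)) (at (\<gamma> 0) within \<gamma> ` I)"
    using assms(1) by (rule has_derivative_subset) (use assms(5) in blast)
  have "((\<lambda>s. \<phi> (\<gamma> s)) has_derivative (\<lambda>h. v \<bullet> h *\<^sub>R d)) (at 0)"
    using has_derivative_in_compose[OF d\<gamma> d\<phi>] at_within_open[OF assms(4,3)] by simp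
  then show ?thesis
    unfolding has_field_derivative_def
    by (rule has_derivative_eq_rhs) (simp add: fun_eq_iff)
qed

text \<open>A derivative within the sphere determines the derivative along every great circle, hence
  the inner product with every tangent direction; the difference of two gradients is itself
  tangent.\<close>

lemma is_sphere_gradient_unique:
  assumes "is_sphere_gradient \<phi> \<xi> v" "is_sphere_gradient \<phi> \<xi> w" "\<xi> \<in> sphere 0 1"
  shows "v = w"
proof (rule ccontr)
  assume "v \<noteq> w"
  define d where "d = (v - w) /\<^sub>R norm (v - w)"
  have d: "norm d = 1" "d \<bullet> \<xi> = 0"
    using \<open>v \<noteq> w\<close> assms(1,2) by (simp_all add: d_def is_sphere_gradient_def inner_diff_left)
  have "norm \<xi> = 1" using assms(3) by simp
  note \<gamma> = sphere_curve[OF this d]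
  have "((\<lambda>s. \<phi> (cos s *\<^sub>R \<xi> + sin s *\<^sub>R d)) has_real_derivative u \<bullet> d) (at 0)"
    if "is_sphere_gradient \<phi> \<xi> u" for u
    by (rule sphere_derivative_along_curve[OF _ \<gamma>(2) open_UNIV UNIV_I \<gamma>(1)])
      (use that in \<open>simp add: is_sphere_gradient_def\<close>)
  then have "v \<bullet> d = w \<bullet> d" using assms(1,2) DERIV_unique by blast
  then have "(v - w) \<bullet> (v - w) = 0"
    using \<open>v \<noteq> w\<close> by (simp add: d_def inner_diff_left)
  then show False using \<open>v \<noteq> w\<close> by simp
qed

lemma sphere_gradient_is_sphere_gradient:
  assumes "C1_on_sphere \<phi>" "\<xi> \<in> sphere 0 1"
  shows "is_sphere_gradient \<phi> \<xi> (sphere_gradient \<phi> \<xi>)"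
proof -
  obtain v where v: "is_sphere_gradient \<phi> \<xi> v"
    using assms unfolding C1_on_sphere_def by blast
  show ?thesis
    unfolding sphere_gradient_def
    by (rule theI[of _ v]) (use v is_sphere_gradient_unique[OF _ _ assms(2)] in auto)
qed

section \<open>Geometry of a hypersurface patch\<close>

text \<open>Near a point, the normal is the constant vector \<open>e\<close>, the normal at that
  point, minus its tangential part, divided by its length. Only first derivatives of the immersion
  occur in this formula.\<close>

lemma unit_normal_Ck:
  fixes \<psi> N :: "real^'n \<Rightarrow> real^'m"
  assumes card: "CARD('m) = CARD('n) + 1" and "open U" and \<psi>: "Ck_on (Suc k) U \<psi>"
    and frame: "\<And>y. y \<in> U \<Longrightarrow> frame (\<lambda>i. partial i \<psi> y)"
    and normal: "\<And>y i. y \<in> U \<Longrightarrow> partial i \<psi> y \<bullet> N y = 0"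
    and unit: "\<And>y. y \<in> U \<Longrightarrow> norm (N y) = 1"
    and cont: "continuous_on U N"
  shows "Ck_on k U N"
proof (rule Ck_on_locally)
  fix x assume "x \<in> U"
  define e where "e = N x"
  \<comment> \<open>Where the normal has a positive inner product with \<open>e\<close>, the formula has the right sign.\<close>
  define V where "V = U \<inter> (\<lambda>y. e \<bullet> N y) -` {0<..}"
  have openV: "open V"
    unfolding V_def
    by (rule continuous_open_preimage[OF _ \<open>open U\<close>]) (intro continuous_intros cont, simp)
  have "x \<in> V"
    using \<open>x \<in> U\<close> unit[of x] by (simp add: V_def e_def dot_square_norm)
  define a where "a y i = partial i \<psi> y" for y i
  define w where "w y = e - tangent_part (a y) e" for y
  have "V \<subseteq> U" by (simp add: V_def)
  have w: "w y = (e \<bullet> N y) *\<^sub>R N y" if "y \<in> U" for y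
    using normal_expansion[OF card frame normal unit, OF that that that, of e]
    by (simp add: w_def a_def[abs_def] algebra_simps)
  have pos: "0 < e \<bullet> w y" if "y \<in> V" for y
    using that w[of y] by (simp add: V_def)
  have Ca: "Ck_on k V (\<lambda>y. a y i)" for i
    unfolding a_def using Ck_on_subset[OF Ck_on_partial[OF \<psi>] \<open>V \<subseteq> U\<close>] by simp
  have Cg: "Ck_on k V (\<lambda>y. gram (a y) $ i $ j)" for i j
    unfolding gram_def vec_lambda_beta by (intro Ck_on_inner openV Ca)
  have det: "det (gram (a y)) \<noteq> 0" if "y \<in> V" for y
    unfolding a_def using frame that \<open>V \<subseteq> U\<close> by (intro det_gram) blast
  have CG: "Ck_on k V (\<lambda>y. matrix_inv (gram (a y)) $ i $ j)" for i j
    by (rule Ck_on_matrix_inv[OF openV Cg det])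
  have "Ck_on k V (\<lambda>y. (matrix_inv (gram (a y)) $ i $ j * (e \<bullet> a y j)) *\<^sub>R a y i)" for i j
    by (rule Ck_on_scaleR[OF openV Ck_on_mult[OF openV CG
        Ck_on_inner[OF openV Ck_on_const Ca]] Ca])
  then have "Ck_on k V (\<lambda>y. tangent_part (a y) e)"
    unfolding tangent_part_def by (rule Ck_on_sum[OF openV Ck_on_sum[OF openV]])
  then have "Ck_on k V (\<lambda>y. e + (-1) *\<^sub>R tangent_part (a y) e)"
    by (rule Ck_on_add[OF openV Ck_on_const Ck_on_scaleR[OF openV Ck_on_const]])
  then have Cw: "Ck_on k V w" by (simp add: w_def[abs_def])
  \<comment> \<open>As \<open>w = \<langle>e, N\<rangle> N\<close>, the length of \<open>w\<close> is the square root of \<open>\<langle>e, w\<rangle>\<close>.\<close>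
  have "Ck_on k V (\<lambda>y. e \<bullet> w y)"
    by (rule Ck_on_inner[OF openV Ck_on_const Cw])
  then have "Ck_on k V (\<lambda>y. sqrt (e \<bullet> w y))"
    by (rule Ck_on_sqrt[OF openV, rotated]) (rule pos)
  then have "Ck_on k V (\<lambda>y. inverse (sqrt (e \<bullet> w y)))"
    by (rule Ck_on_inverse[OF openV, rotated]) (use pos in force)
  then have CN: "Ck_on k V (\<lambda>y. inverse (sqrt (e \<bullet> w y)) *\<^sub>R w y)"
    by (rule Ck_on_scaleR[OF openV _ Cw])
  have "inverse (sqrt (e \<bullet> w y)) *\<^sub>R w y = N y" if "y \<in> V" for y
    using that w[of y] by (simp add: V_def flip: power2_eq_square)
  from Ck_on_cong[OF openV this CN] have "Ck_on k V N" .
  then show "\<exists>U. open U \<and> x \<in> U \<and> Ck_on k U N" using openV \<open>x \<in> V\<close> by blast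
qed

text \<open>A hypersurface read in a chart with range \<open>U\<close>. The normal is required to be
  of class \<open>C\<^sup>2\<close>, as it is when the immersion is of class
  \<open>C\<^sup>3\<close>, so that normal variations are of class \<open>C\<^sup>2\<close>.\<close>

locale hypersurface_patch =
  fixes U :: "(real^'n) set" and \<psi> \<eta> :: "real^'n \<Rightarrow> real^'m"
  assumes card: "CARD('m) = CARD('n) + 1" and open_U: "open U"
    and C2_\<psi>: "Ck_on 2 U \<psi>" and C2_\<eta>: "Ck_on 2 U \<eta>"
    and frame: "\<And>y. y \<in> U \<Longrightarrow> frame (\<lambda>i. partial i \<psi> y)"
    and normal: "\<And>y i. y \<in> U \<Longrightarrow> partial i \<psi> y \<bullet> \<eta> y = 0"
    and unit: "\<And>y. y \<in> U \<Longrightarrow> norm (\<eta> y) = 1"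
begin

lemma differentiable_\<psi>:
  "y \<in> U \<Longrightarrow> \<psi> differentiable (at y)" "y \<in> U \<Longrightarrow> partial i \<psi> differentiable (at y)"
  using C2_\<psi> by (auto simp: numeral_2_eq_2 partial_def[abs_def])

lemma differentiable_\<eta>:
  "y \<in> U \<Longrightarrow> \<eta> differentiable (at y)" "y \<in> U \<Longrightarrow> partial i \<eta> differentiable (at y)"
  using C2_\<eta> by (auto simp: numeral_2_eq_2 partial_def[abs_def])

abbreviation (input) sff :: "real^'n \<Rightarrow> 'n \<Rightarrow> 'n \<Rightarrow> real" where
  "sff x i j \<equiv> partial i (partial j \<psi>) x \<bullet> \<eta> x"

lemma sff_commute: "x \<in> U \<Longrightarrow> sff x i j = sff x j i"
  using partial_commute[OF open_U _ C2_\<psi>] by simp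

text \<open>The Weingarten equation, from differentiating \<open>\<langle>\<partial>\<^sub>j \<psi>,
  \<eta>\<rangle> = 0\<close>.\<close>

lemma normal_derivative_inner_tangent:
  assumes "x \<in> U"
  shows "partial i \<eta> x \<bullet> partial j \<psi> x = - sff x i j"
proof -
  have "partial i (\<lambda>y. partial j \<psi> y \<bullet> \<eta> y) x = partial i (\<lambda>y. 0) x"
    by (rule partial_cong[OF _ open_U assms])
      (simp_all add: differentiable_\<psi> differentiable_\<eta> assms normal)
  then show ?thesis
    by (simp add: partial_inner differentiable_\<psi> differentiable_\<eta> assms
        inner_commute[of "partial j \<psi> x"])
qed

lemma normal_derivative_inner_normal:
  assumes "x \<in> U"
  shows "partial i \<eta> x \<bullet> \<eta> x = 0"
proof -
  have "\<eta> y \<bullet> \<eta> y = 1" if "y \<in> U" for y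
    using unit[OF that] by (simp only: norm_eq_1)
  then have "partial i (\<lambda>y. \<eta> y \<bullet> \<eta> y) x = partial i (\<lambda>y. 1) x"
    by (intro partial_cong[OF _ open_U assms] differentiable_inner differentiable_\<eta> assms)
  then show ?thesis
    by (simp add: partial_inner differentiable_\<eta> assms inner_commute[of "\<eta> x"])
qed

text \<open>The derivative of the normal is tangent, so its inner products can be computed from
  those with the frame.\<close>

lemma third_fundamental_form:
  assumes "x \<in> U"
  shows "partial i \<eta> x \<bullet> partial j \<eta> x
    = (\<Sum>k\<in>UNIV. \<Sum>l\<in>UNIV. matrix_inv (gram (\<lambda>i. partial i \<psi> x)) $ k $ l * sff x i k * sff x j l)"
  using inner_normal_expansion[OF card frame[OF assms] normal[OF assms] unit[OF assms],
      of "partial i \<eta> x" "partial j \<eta> x"] assms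
  by (simp add: normal_derivative_inner_tangent normal_derivative_inner_normal)

lemma variation_C2: "Ck_on 2 U f \<Longrightarrow> Ck_on 2 U (\<lambda>y. f y *\<^sub>R \<eta> y)"
  by (rule Ck_on_scaleR[OF open_U _ C2_\<eta>])

context
  fixes f :: "real^'n \<Rightarrow> real" and x :: "real^'n"
  assumes C2_f: "Ck_on 2 U f" and x: "x \<in> U"
begin

lemma differentiable_f:
  "y \<in> U \<Longrightarrow> f differentiable (at y)" "y \<in> U \<Longrightarrow> partial i f differentiable (at y)"
  using C2_f by (auto simp: numeral_2_eq_2 partial_def[abs_def])

lemma variation_partial:
  "y \<in> U \<Longrightarrow> partial i (\<lambda>y. f y *\<^sub>R \<eta> y) y = partial i f y *\<^sub>R \<eta> y + f y *\<^sub>R partial i \<eta> y"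
  by (simp add: partial_scaleR differentiable_f differentiable_\<eta>)

lemma variation_partial_differentiable:
  "partial i (\<lambda>y. f y *\<^sub>R \<eta> y) differentiable (at x)"
  using variation_C2[OF C2_f] x by (auto simp: numeral_2_eq_2 partial_def[abs_def])

lemma variation_partial_inner_normal:
  assumes "y \<in> U"
  shows "partial i (\<lambda>y. f y *\<^sub>R \<eta> y) y \<bullet> \<eta> y = partial i f y"
  using assms
  by (simp add: variation_partial inner_add_left normal_derivative_inner_normal unit dot_square_norm)

lemma variation_partial_inner_tangent:
  "partial i (\<lambda>y. f y *\<^sub>R \<eta> y) x \<bullet> partial j \<psi> x = - f x * sff x i j"
  using x normal[OF x, of j]
  by (simp add: variation_partial inner_add_left normal_derivative_inner_tangent
      inner_commute[of "\<eta> x"])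

text \<open>Differentiate \<open>\<langle>\<partial>\<^sub>j (f \<eta>), \<eta>\<rangle> =
  \<partial>\<^sub>j f\<close>; no second derivative of \<open>\<eta>\<close> has to be
  computed.\<close>

lemma variation_second_partial_inner_normal:
  "partial i (partial j (\<lambda>y. f y *\<^sub>R \<eta> y)) x \<bullet> \<eta> x
    = partial i (partial j f) x - f x * (partial j \<eta> x \<bullet> partial i \<eta> x)"
proof -
  have "partial i (\<lambda>y. partial j (\<lambda>y. f y *\<^sub>R \<eta> y) y \<bullet> \<eta> y) x = partial i (partial j f) x"
    by (rule partial_cong[OF _ open_U x])
      (simp_all add: variation_partial_differentiable differentiable_\<eta> x
        variation_partial_inner_normal)
  then have "partial i (partial j (\<lambda>y. f y *\<^sub>R \<eta> y)) x \<bullet> \<eta> x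
      + partial j (\<lambda>y. f y *\<^sub>R \<eta> y) x \<bullet> partial i \<eta> x = partial i (partial j f) x"
    by (simp add: partial_inner variation_partial_differentiable differentiable_\<eta> x)
  moreover have "partial j (\<lambda>y. f y *\<^sub>R \<eta> y) x \<bullet> partial i \<eta> x
      = f x * (partial j \<eta> x \<bullet> partial i \<eta> x)"
    using normal_derivative_inner_normal[OF x, of i]
    by (simp add: variation_partial x inner_add_left inner_commute[of "\<eta> x"])
  ultimately show ?thesis by simp
qed

end

end

text \<open>The index bookkeeping of the first variation. In the application \<open>G\<close> is the
  inverse metric, \<open>h\<close> the second fundamental form, \<open>F\<close> the matrix of
  second partial derivatives of the function, \<open>f\<close> its Christoffel correction and
  \<open>c\<close> its value. The contribution of \<open>h'\<close> contains \<open>- c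
  |\<sigma>|\<^sup>2\<close>, that of the inverse metric \<open>+ 2 c
  |\<sigma>|\<^sup>2\<close>.\<close>

lemma curvature_contraction:
  fixes G h F f :: "'n::finite \<Rightarrow> 'n \<Rightarrow> real" and c :: real
  assumes G: "\<And>i j. G i j = G j i" and h: "\<And>i j. h i j = h j i"
  shows "(\<Sum>i\<in>UNIV. \<Sum>j\<in>UNIV. G i j * (f j i + (F j i - c * (\<Sum>k\<in>UNIV. \<Sum>l\<in>UNIV. G k l * h i k * h j l)))
      - (\<Sum>k\<in>UNIV. \<Sum>l\<in>UNIV. G i k * (- 2 * c * h k l) * G l j) * h j i)
    = (\<Sum>i\<in>UNIV. \<Sum>j\<in>UNIV. G i j * (F i j + f i j))
      + (\<Sum>i\<in>UNIV. \<Sum>j\<in>UNIV. \<Sum>k\<in>UNIV. \<Sum>l\<in>UNIV. G i k * G j l * h i j * h k l) * c"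
proof -
  define T where "T i j = (\<Sum>k\<in>UNIV. \<Sum>l\<in>UNIV. G k l * h i k * h j l)" for i j
  define R where "R i j = (\<Sum>k\<in>UNIV. \<Sum>l\<in>UNIV. G i k * (- 2 * c * h k l) * G l j) * h j i" for i j
  define Q where "Q = (\<Sum>i\<in>UNIV. \<Sum>j\<in>UNIV. \<Sum>k\<in>UNIV. \<Sum>l\<in>UNIV. G i k * G j l * h i j * h k l)"
  have T: "(\<Sum>i\<in>UNIV. \<Sum>j\<in>UNIV. G i j * T i j) = Q"
  proof -
    have "(\<Sum>i\<in>UNIV. \<Sum>j\<in>UNIV. G i j * T i j)
        = (\<Sum>i\<in>UNIV. \<Sum>j\<in>UNIV. \<Sum>k\<in>UNIV. \<Sum>l\<in>UNIV. G i j * G k l * h i k * h j l)"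
      by (simp add: T_def sum_distrib_left mult.assoc)
    also have "\<dots> = (\<Sum>i\<in>UNIV. \<Sum>k\<in>UNIV. \<Sum>j\<in>UNIV. \<Sum>l\<in>UNIV. G i j * G k l * h i k * h j l)"
      by (intro sum.cong refl sum.swap)
    finally show ?thesis by (simp only: Q_def)
  qed
  have R: "(\<Sum>i\<in>UNIV. \<Sum>j\<in>UNIV. R i j) = - 2 * c * Q"
  proof -
    have summand: "G i k * (- 2 * c * h k l) * G l j * h j i = - 2 * c * (G i k * G j l * h i j * h k l)"
      for i j k l
      unfolding G[of l j] h[of j i] by simp
    show ?thesis
      unfolding R_def Q_def sum_distrib_left sum_distrib_right by (intro sum.cong refl summand)
  qed
  have S: "(\<Sum>i\<in>UNIV. \<Sum>j\<in>UNIV. G i j * (f j i + F j i)) = (\<Sum>i\<in>UNIV. \<Sum>j\<in>UNIV. G i j * (F i j + f i j))"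
  proof (subst sum.swap, intro sum.cong refl)
    show "G j i * (f i j + F i j) = G i j * (F i j + f i j)" for i j
      unfolding G[of j i] by simp
  qed
  have "(\<Sum>i\<in>UNIV. \<Sum>j\<in>UNIV. G i j * (f j i + (F j i - c * T i j)) - R i j)
      = (\<Sum>i\<in>UNIV. \<Sum>j\<in>UNIV. G i j * (f j i + F j i) - c * (G i j * T i j) - R i j)"
    by (intro sum.cong refl) (simp add: algebra_simps)
  also have "\<dots> = (\<Sum>i\<in>UNIV. \<Sum>j\<in>UNIV. G i j * (f j i + F j i)) - c * Q - (- 2 * c * Q)"
    unfolding sum_subtractf R T[symmetric] sum_distrib_left ..
  also have "\<dots> = (\<Sum>i\<in>UNIV. \<Sum>j\<in>UNIV. G i j * (F i j + f i j)) + Q * c"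
    unfolding S by simp
  finally show ?thesis unfolding T_def R_def Q_def .
qed

section \<open>First variation in a patch and passage to charts\<close>

context hypersurface_patch
begin

text \<open>Gauss' formula: the Christoffel symbols of the induced metric are the tangential
  components of the second derivatives of the immersion.\<close>

lemma christoffel_numerator:
  assumes "x \<in> U"
  shows "partial i (\<lambda>y. gram (\<lambda>i. partial i \<psi> y) $ j $ l) x
      + partial j (\<lambda>y. gram (\<lambda>i. partial i \<psi> y) $ i $ l) x
      - partial l (\<lambda>y. gram (\<lambda>i. partial i \<psi> y) $ i $ j) x
    = 2 * (partial i (partial j \<psi>) x \<bullet> partial l \<psi> x)"
proof -
  have metric: "partial i (\<lambda>y. gram (\<lambda>i. partial i \<psi> y) $ j $ l) x
      = partial i (partial j \<psi>) x \<bullet> partial l \<psi> x + partial j \<psi> x \<bullet> partial i (partial l \<psi>) x" for i j l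
    unfolding gram_def vec_lambda_beta
    by (rule partial_inner) (rule differentiable_\<psi>(2)[OF assms])+
  have comm: "partial i (partial j \<psi>) x = partial j (partial i \<psi>) x" for i j
    by (rule partial_commute[OF open_U assms C2_\<psi>])
  show ?thesis
    unfolding metric comm[of j i] comm[of l i] comm[of l j]
    by (simp add: inner_commute)
qed

text \<open>The first variation formulas: \<open>\<nu>' = - \<nabla>f\<close> for the normal, and
  \<open>\<Delta>f + |\<sigma>|\<^sup>2 f\<close> for the trace of the shape operator. The
  Christoffel symbols of the Hessian come from \<open>\<langle>\<partial>\<^sub>i \<partial>\<^sub>j
  \<psi>, \<nu>'\<rangle>\<close>.\<close>

lemma first_variation:
  fixes f :: "real^'n \<Rightarrow> real" and \<nu> :: "real \<Rightarrow> real^'m"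
  assumes f: "Ck_on 2 U f" and x: "x \<in> U"
  defines "a \<equiv> \<lambda>i. partial i \<psi> x" and "b \<equiv> \<lambda>i. partial i (\<lambda>y. f y *\<^sub>R \<eta> y) x"
    and "q \<equiv> \<lambda>i j. partial i (partial j \<psi>) x"
    and "r \<equiv> \<lambda>i j. partial i (partial j (\<lambda>y. f y *\<^sub>R \<eta> y)) x"
  defines "G \<equiv> matrix_inv (gram a)"
  assumes "0 < \<epsilon>"
    and frame_t: "\<And>t. \<bar>t\<bar> < \<epsilon> \<Longrightarrow> frame (\<lambda>i. a i + t *\<^sub>R b i)"
    and normal_t: "\<And>t i. \<bar>t\<bar> < \<epsilon> \<Longrightarrow> (a i + t *\<^sub>R b i) \<bullet> \<nu> t = 0"
    and unit_t: "\<And>t. \<bar>t\<bar> < \<epsilon> \<Longrightarrow> norm (\<nu> t) = 1"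
    and cont: "isCont \<nu> 0" and \<nu>0: "\<nu> 0 = \<eta> x"
  shows "(\<nu> has_vector_derivative
      - (\<Sum>i\<in>UNIV. \<Sum>j\<in>UNIV. (G $ i $ j * partial j f x) *\<^sub>R a i)) (at 0)"
    and "((\<lambda>t. trace (matrix_inv (gram (\<lambda>i. a i + t *\<^sub>R b i)) **
          (\<chi> i j. (q i j + t *\<^sub>R r i j) \<bullet> \<nu> t)))
      has_real_derivative
        (\<Sum>i\<in>UNIV. \<Sum>j\<in>UNIV. G $ i $ j * (partial i (partial j f) x
            - (\<Sum>k\<in>UNIV. (\<Sum>l\<in>UNIV. G $ k $ l * (q i j \<bullet> a l)) * partial k f x)))
        + (\<Sum>i\<in>UNIV. \<Sum>j\<in>UNIV. \<Sum>k\<in>UNIV. \<Sum>l\<in>UNIV.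
            G $ i $ k * G $ j $ l * sff x i j * sff x k l) * f x) (at 0)"
proof -
  define \<nu>' where "\<nu>' = - (\<Sum>i\<in>UNIV. \<Sum>j\<in>UNIV. (G $ i $ j * partial j f x) *\<^sub>R a i)"
  have frame0: "frame a" unfolding a_def by (rule frame[OF x])
  have bN: "\<nu> 0 \<bullet> b j = partial j f x" for j
    unfolding \<nu>0 b_def
    by (subst inner_commute) (rule variation_partial_inner_normal[OF f x x])
  show deriv: "(\<nu> has_vector_derivative
      - (\<Sum>i\<in>UNIV. \<Sum>j\<in>UNIV. (G $ i $ j * partial j f x) *\<^sub>R a i)) (at 0)"
    using unit_normal_has_derivative[OF card \<open>0 < \<epsilon>\<close> frame_t normal_t unit_t cont]
    by (simp only: bN G_def)
  have Gsym: "G $ i $ j = G $ j $ i" for i j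
    unfolding G_def by (rule matrix_inv_symmetric[OF det_gram[OF frame0] transpose_gram])
  have ab: "a k \<bullet> b l + b k \<bullet> a l = - 2 * f x * sff x k l" for k l
    using variation_partial_inner_tangent[OF f x, of l k]
      variation_partial_inner_tangent[OF f x, of k l] sff_commute[OF x, of k l]
    unfolding a_def b_def by (simp add: inner_commute)
  have rN: "r j i \<bullet> \<nu> 0 = partial j (partial i f) x - f x * (\<Sum>k\<in>UNIV. \<Sum>l\<in>UNIV.
      G $ k $ l * sff x i k * sff x j l)" for i j
    unfolding \<nu>0 r_def variation_second_partial_inner_normal[OF f x] third_fundamental_form[OF x]
      G_def a_def ..
  have q\<nu>': "q i j \<bullet> \<nu>' = - (\<Sum>k\<in>UNIV. (\<Sum>l\<in>UNIV. G $ k $ l * (q i j \<bullet> a l)) * partial k f x)" for i j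
  proof -
    have "q i j \<bullet> \<nu>' = - (\<Sum>l\<in>UNIV. \<Sum>k\<in>UNIV. G $ l $ k * partial k f x * (q i j \<bullet> a l))"
      by (simp add: \<nu>'_def inner_sum_right)
    also have "\<dots> = - (\<Sum>k\<in>UNIV. \<Sum>l\<in>UNIV. G $ l $ k * partial k f x * (q i j \<bullet> a l))"
      by (subst sum.swap) (rule refl)
    also have "\<dots> = - (\<Sum>k\<in>UNIV. (\<Sum>l\<in>UNIV. G $ k $ l * (q i j \<bullet> a l)) * partial k f x)"
      unfolding sum_distrib_right
      by (intro arg_cong[where f = uminus] sum.cong refl) (simp add: Gsym ac_simps)
    finally show ?thesis .
  qed
  have qN: "q i j \<bullet> \<nu> 0 = sff x i j" for i j by (simp add: q_def \<nu>0)
  show "((\<lambda>t. trace (matrix_inv (gram (\<lambda>i. a i + t *\<^sub>R b i)) **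
          (\<chi> i j. (q i j + t *\<^sub>R r i j) \<bullet> \<nu> t)))
      has_real_derivative
        (\<Sum>i\<in>UNIV. \<Sum>j\<in>UNIV. G $ i $ j * (partial i (partial j f) x
            - (\<Sum>k\<in>UNIV. (\<Sum>l\<in>UNIV. G $ k $ l * (q i j \<bullet> a l)) * partial k f x)))
        + (\<Sum>i\<in>UNIV. \<Sum>j\<in>UNIV. \<Sum>k\<in>UNIV. \<Sum>l\<in>UNIV.
            G $ i $ k * G $ j $ l * sff x i j * sff x k l) * f x) (at 0)"
    using trace_inverse_gram_has_derivative[OF frame0 deriv[folded \<nu>'_def], of b q r]
      curvature_contraction[of "\<lambda>i j. G $ i $ j" "sff x"
        "\<lambda>i j. - (\<Sum>k\<in>UNIV. (\<Sum>l\<in>UNIV. G $ k $ l * (q i j \<bullet> a l)) * partial k f x)"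
        "\<lambda>i j. partial i (partial j f) x" "f x", OF Gsym sff_commute[OF x]]
    unfolding G_def[symmetric] ab rN q\<nu>' qN by (simp only: diff_conv_add_uminus)
qed

end

lemma frame_iff_inj_frechet_derivative:
  assumes "f differentiable (at x)"
  shows "frame (\<lambda>i. partial i f x) \<longleftrightarrow> inj (frechet_derivative f (at x))"
  using linear_injective_0[OF linear_frechet_derivative[OF assms]]
  by (simp add: frame_def frechet_derivative_partials[OF assms])

lemma chart_inj:
  assumes "is_chart \<Sigma> c"
  shows "inj_on (cmap c) (cdom c)"
proof -
  have "inj_on (cmap c) (topspace (subtopology \<Sigma> (cdom c)))"
    using assms unfolding is_chart_def by (blast intro: homeomorphic_imp_injective_map)
  moreover have "cdom c \<subseteq> topspace \<Sigma>"
    using assms unfolding is_chart_def by (blast dest: openin_subset)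
  ultimately show ?thesis by (simp add: Int_absorb1)
qed

lemma in_chart_cmap:
  assumes "is_chart \<Sigma> c" "p \<in> cdom c"
  shows "in_chart c F (cmap c p) = F p"
  using chart_inj[OF assms(1)] assms(2) by (simp add: in_chart_def)

lemma chart_continuous_map:
  assumes "is_chart \<Sigma> c"
  shows "continuous_map (subtopology \<Sigma> (cdom c)) euclidean (cmap c)"
  using assms unfolding is_chart_def
  by (blast dest: homeomorphic_imp_continuous_map continuous_map_into_fulltopology)

lemma chart_openin_preimage:
  assumes "is_chart \<Sigma> c" "open V"
  shows "openin \<Sigma> {p \<in> cdom c. cmap c p \<in> V}"
proof -
  have "openin (subtopology \<Sigma> (cdom c)) {p \<in> topspace (subtopology \<Sigma> (cdom c)). cmap c p \<in> V}"
    using openin_continuous_map_preimage[OF chart_continuous_map[OF assms(1)]] assms(2)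
    by simp
  moreover have "openin \<Sigma> (cdom c)" using assms(1) by (simp add: is_chart_def)
  moreover from this have "topspace \<Sigma> \<inter> cdom c = cdom c" using openin_subset by blast
  ultimately show ?thesis by (simp add: openin_open_subtopology)
qed

lemma chart_open_image:
  assumes "is_chart \<Sigma> c" "openin \<Sigma> W" "W \<subseteq> cdom c"
  shows "open (cmap c ` W)"
proof -
  have c: "openin \<Sigma> (cdom c)" "open (crange c)"
    "homeomorphic_map (subtopology \<Sigma> (cdom c)) (top_of_set (crange c)) (cmap c)"
    using assms(1) by (simp_all add: is_chart_def)
  have "openin (subtopology \<Sigma> (cdom c)) W"
    using assms(2,3) c(1) by (simp add: openin_open_subtopology)
  then have "openin (top_of_set (crange c)) (cmap c ` W)"
    using homeomorphic_map_openness_eq[OF c(3)] by blast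
  then show ?thesis using c(2) openin_open_trans by blast
qed

lemma in_chart_continuous_on:
  fixes N :: "'p \<Rightarrow> 'b::topological_space"
  assumes "is_chart \<Sigma> c" "continuous_map \<Sigma> euclidean N"
  shows "continuous_on (crange c) (in_chart c N)"
proof -
  obtain g where g: "homeomorphic_maps (subtopology \<Sigma> (cdom c)) (top_of_set (crange c)) (cmap c) g"
    using assms(1) unfolding is_chart_def homeomorphic_map_maps by blast
  then have "continuous_map (top_of_set (crange c)) (subtopology \<Sigma> (cdom c)) g"
    by (simp add: homeomorphic_maps_def)
  then have "continuous_map (top_of_set (crange c)) \<Sigma> g"
    by (rule continuous_map_into_fulltopology)
  then have "continuous_map (top_of_set (crange c)) euclidean (N \<circ> g)"
    by (rule continuous_map_compose[OF _ assms(2)])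
  then have "continuous_on (crange c) (N \<circ> g)"
    by (simp only: continuous_map_iff_continuous)
  moreover have "(N \<circ> g) y = in_chart c N y" if y: "y \<in> crange c" for y
  proof -
    obtain p where p: "p \<in> cdom c" "y = cmap c p" using y by blast
    have "openin \<Sigma> (cdom c)" using assms(1) by (simp add: is_chart_def)
    then have "p \<in> topspace (subtopology \<Sigma> (cdom c))"
      using p(1) openin_subset by fastforce
    then have "g y = p" using g p(2) unfolding homeomorphic_maps_def by blast
    then show ?thesis using p by (simp add: in_chart_cmap[OF assms(1)])
  qed
  ultimately show ?thesis by (simp cong: continuous_on_cong)
qed

text \<open>Translates the conditions on an immersed hypersurface into conditions on the maps read
  in one chart, where the point \<open>p\<close> is replaced by its coordinates.\<close>

lemma oriented_hypersurface_chart: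
  fixes F :: "'p \<Rightarrow> real^'m" and c :: "('p, 'n::finite) chart"
  assumes "oriented_hypersurface (Suc k) \<Sigma> A F N" "c \<in> A"
  shows "is_chart \<Sigma> c" "open (crange c)" "Ck_on (Suc k) (crange c) (in_chart c F)"
    and "y \<in> crange c \<Longrightarrow> frame (\<lambda>i. partial i (in_chart c F) y)"
    and "y \<in> crange c \<Longrightarrow> partial i (in_chart c F) y \<bullet> in_chart c N y = 0"
    and "y \<in> crange c \<Longrightarrow> norm (in_chart c N y) = 1"
    and "continuous_on (crange c) (in_chart c N)"
proof -
  note assms(1)[unfolded oriented_hypersurface_def]
  then have man: "Ck_manifold (Suc k) \<Sigma> A" and F: "Ck_map (Suc k) A F"
    and inj: "\<And>x. x \<in> crange c \<Longrightarrow> inj (frechet_derivative (in_chart c F) (at x))"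
    and N: "continuous_map \<Sigma> euclidean N" and unit: "\<And>p. p \<in> topspace \<Sigma> \<Longrightarrow> norm (N p) = 1"
    and normal: "\<And>p v. p \<in> cdom c \<Longrightarrow>
      frechet_derivative (in_chart c F) (at (cmap c p)) v \<bullet> N p = 0"
    using assms(2) by auto
  show c: "is_chart \<Sigma> c" using man assms(2) by (simp add: Ck_manifold_def)
  then show "open (crange c)" by (simp add: is_chart_def)
  show F': "Ck_on (Suc k) (crange c) (in_chart c F)" using F assms(2) by (simp add: Ck_map_def)
  show "continuous_on (crange c) (in_chart c N)" by (rule in_chart_continuous_on[OF c N])
  assume y: "y \<in> crange c"
  then have "in_chart c F differentiable (at y)" using F' by auto
  then show "frame (\<lambda>i. partial i (in_chart c F) y)"
    using inj[OF y] by (simp add: frame_iff_inj_frechet_derivative)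
  obtain p where p: "p \<in> cdom c" "y = cmap c p" using y by blast
  have "p \<in> topspace \<Sigma>" using c p(1) openin_subset unfolding is_chart_def by blast
  then show "norm (in_chart c N y) = 1" using unit p by (simp add: in_chart_cmap[OF c])
  show "partial i (in_chart c F) y \<bullet> in_chart c N y = 0"
    using normal[OF p(1)] p by (simp add: partial_def in_chart_cmap[OF c])
qed

text \<open>The shape operator is self-adjoint for the inner product given by the Gram matrix,
  because the product of the Gram matrix with it is the symmetric matrix \<open>h\<close>.\<close>

lemma shape_operator_trace:
  fixes a :: "'n::finite \<Rightarrow> 'a::real_inner" and h :: "real^'n^'n"
  assumes "frame a" "\<And>i j. h $ i $ j = h $ j $ i"
  defines "S \<equiv> matrix_inv (gram a) ** h"
  shows "(\<Sum>\<kappa> | {u. S *v u = \<kappa> *\<^sub>R u} \<noteq> {0}. real (dim {u. S *v u = \<kappa> *\<^sub>R u}) * \<kappa>) = trace S"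
proof -
  have symmetric: "u \<bullet> (M *v v) = v \<bullet> (M *v u)" if "transpose M = M" for M :: "real^'n^'n" and u v
    using that by (metis dot_lmul_matrix inner_commute transpose_matrix_vector)
  have G: "u \<bullet> (gram a *v v) = v \<bullet> (gram a *v u)" for u v
    by (rule symmetric[OF transpose_gram])
  have pos: "0 < u \<bullet> (gram a *v u)" if "u \<noteq> 0" for u
    using assms(1) that unfolding gram_quadratic_form frame_def by auto
  have "gram a *v (S *v u) = h *v u" for u
    by (simp add: S_def matrix_vector_mul_assoc matrix_mul_assoc matrix_inv_mult det_gram assms(1))
  moreover have "transpose h = h" using assms(2) by (simp add: transpose_def vec_eq_iff)
  ultimately have selfadj: "u \<bullet> (gram a *v (S *v v)) = v \<bullet> (gram a *v (S *v u))" for u v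
    using symmetric by simp
  obtain B where "independent B" "span B = UNIV" "\<forall>b\<in>B. \<exists>\<mu>. S *v b = \<mu> *\<^sub>R b"
    using self_adjoint_eigenbasis[OF G pos selfadj subspace_UNIV] by auto
  then show ?thesis using sum_eigenvalues_eq_trace[of B S] by blast
qed

lemma mean_curvature_eq_trace:
  fixes F N :: "'p \<Rightarrow> real^'m" and c :: "('p, 'n::finite) chart"
  assumes "oriented_hypersurface 2 \<Sigma> A F N" "c \<in> A" "p \<in> cdom c"
  shows "real CARD('n) * mean_curvature c F N p
    = trace (matrix_inv (gram (\<lambda>i. partial i (in_chart c F) (cmap c p))) **
        (\<chi> i j. partial i (partial j (in_chart c F)) (cmap c p) \<bullet> N p))"
proof -
  note c = oriented_hypersurface_chart[OF assms(1)[unfolded numeral_2_eq_2] assms(2)]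
  have x: "cmap c p \<in> crange c" using assms(3) by simp
  have "second_fundamental_form c F N p $ i $ j = second_fundamental_form c F N p $ j $ i" for i j
    using partial_commute[OF c(2) x, of "in_chart c F" i j] c(3)
    by (simp add: second_fundamental_form_def numeral_2_eq_2)
  note trace = shape_operator_trace[OF c(4)[OF x] this]
  have "shape_operator c F N p = matrix_inv (gram (\<lambda>i. partial i (in_chart c F) (cmap c p)))
      ** second_fundamental_form c F N p"
    by (simp add: shape_operator_def inv_metric_def metric_def gram_def)
  then show ?thesis
    using trace
    by (simp add: mean_curvature_def principal_curvatures_def principal_space_def
        second_fundamental_form_def)
qed

section \<open>The normal variation of a hypersurface\<close>

lemma continuous_map_in_charts:
  fixes N :: "'p \<Rightarrow> 'b::topological_space"
  assumes "\<And>p. p \<in> topspace \<Sigma> \<Longrightarrow>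
    \<exists>c::('p, 'n::finite) chart. is_chart \<Sigma> c \<and> p \<in> cdom c \<and> continuous_on (crange c) (in_chart c N)"
  shows "continuous_map \<Sigma> euclidean N"
  unfolding continuous_map_def
proof (intro conjI allI impI)
  fix O' :: "'b set" assume O': "openin euclidean O'"
  show "openin \<Sigma> {x \<in> topspace \<Sigma>. N x \<in> O'}"
  proof (subst openin_subopen, intro ballI)
    fix p assume p: "p \<in> {x \<in> topspace \<Sigma>. N x \<in> O'}"
    then obtain c :: "('p, 'n) chart"
      where c: "is_chart \<Sigma> c" "p \<in> cdom c" "continuous_on (crange c) (in_chart c N)"
      using assms by blast
    have "open (crange c)" using c(1) by (simp add: is_chart_def)
    then have "open (crange c \<inter> in_chart c N -` O')"
      using continuous_open_preimage[OF c(3)] O' by simp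
    then have W: "openin \<Sigma> {q \<in> cdom c. cmap c q \<in> crange c \<inter> in_chart c N -` O'}"
      by (rule chart_openin_preimage[OF c(1)])
    have "{q \<in> cdom c. cmap c q \<in> crange c \<inter> in_chart c N -` O'} = {q \<in> cdom c. N q \<in> O'}"
      by (intro Collect_cong conj_cong refl) (simp add: in_chart_cmap[OF c(1)])
    with W have W: "openin \<Sigma> {q \<in> cdom c. N q \<in> O'}" by simp
    have "q \<in> topspace \<Sigma>" if "q \<in> cdom c" for q
      using c(1) that openin_subset unfolding is_chart_def by blast
    then show "\<exists>T. openin \<Sigma> T \<and> p \<in> T \<and> T \<subseteq> {x \<in> topspace \<Sigma>. N x \<in> O'}"
      using W p c(2) by (intro exI[of _ "{q \<in> cdom c. N q \<in> O'}"]) auto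
  qed
qed simp

text \<open>The chain rule for the transition map. It shows that the tangent space, that is the
  range of the derivative, is the same in all charts.\<close>

lemma frechet_derivative_change_of_chart:
  fixes F :: "'p \<Rightarrow> 'b::real_normed_vector" and c d :: "('p, 'n::finite) chart"
  assumes "Ck_manifold (Suc k) \<Sigma> A" "c \<in> A" "d \<in> A" "p \<in> cdom c" "p \<in> cdom d"
    and "in_chart d F differentiable (at (cmap d p))"
  shows "frechet_derivative (in_chart c F) (at (cmap c p)) =
    frechet_derivative (in_chart d F) (at (cmap d p)) \<circ>
    frechet_derivative (in_chart c (cmap d)) (at (cmap c p))"
proof -
  have c: "is_chart \<Sigma> c" and d: "is_chart \<Sigma> d"
    and trans: "Ck_on (Suc k) (cmap c ` (cdom c \<inter> cdom d)) (in_chart c (cmap d))"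
    using assms(1-3) unfolding Ck_manifold_def by blast+
  have opn: "open (cmap c ` (cdom c \<inter> cdom d))"
    using c d by (intro chart_open_image[OF c]) (auto simp: is_chart_def)
  have mem: "cmap c p \<in> cmap c ` (cdom c \<inter> cdom d)" using assms(4,5) by blast
  have T: "in_chart c (cmap d) differentiable (at (cmap c p))" using trans mem by auto
  have F: "in_chart d F differentiable (at (in_chart c (cmap d) (cmap c p)))"
    using assms(6) by (simp add: in_chart_cmap[OF c assms(4)])
  have "frechet_derivative (in_chart d F \<circ> in_chart c (cmap d)) (at (cmap c p))
      = frechet_derivative (in_chart c F) (at (cmap c p))"
  proof (rule frechet_derivative_transform_within_open[OF differentiable_chain_at[OF T F] opn mem])
    show "(in_chart d F \<circ> in_chart c (cmap d)) y = in_chart c F y"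
      if y: "y \<in> cmap c ` (cdom c \<inter> cdom d)" for y
    proof -
      obtain q where "q \<in> cdom c" "q \<in> cdom d" "y = cmap c q" using y by blast
      then show ?thesis by (simp add: in_chart_cmap[OF c] in_chart_cmap[OF d])
    qed
  qed
  then show ?thesis
    using frechet_derivative_compose[OF T F] by (simp add: in_chart_cmap[OF c assms(4)])
qed

text \<open>The vector \<open>e\<close> minus its tangential part, normalized: the unit normal on
  the side of \<open>e\<close> in codimension one.\<close>

definition unit_normal_towards :: "('n::finite \<Rightarrow> 'a::real_inner) \<Rightarrow> 'a \<Rightarrow> 'a" where
  "unit_normal_towards a e = sgn (e - tangent_part a e)"

lemma minus_tangent_part_nonzero:
  assumes "\<And>v. (\<Sum>i\<in>UNIV. v $ i *\<^sub>R a i) \<noteq> e"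
  shows "e - tangent_part a e \<noteq> 0"
proof
  obtain v where "tangent_part a e = (\<Sum>i\<in>UNIV. v $ i *\<^sub>R a i)"
    using tangent_part_in_span[of a e] by blast
  moreover assume "e - tangent_part a e = 0"
  ultimately show False using assms[of v] by simp
qed

lemma unit_normal_towards:
  assumes "frame a" "\<And>v. (\<Sum>i\<in>UNIV. v $ i *\<^sub>R a i) \<noteq> e"
  shows "norm (unit_normal_towards a e) = 1" "a i \<bullet> unit_normal_towards a e = 0"
    and "0 < unit_normal_towards a e \<bullet> e"
proof -
  define w where "w = e - tangent_part a e"
  have "w \<noteq> 0" unfolding w_def by (rule minus_tangent_part_nonzero) (rule assms(2))
  then show "norm (unit_normal_towards a e) = 1"
    by (simp add: unit_normal_towards_def norm_sgn flip: w_def)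
  have wa: "w \<bullet> a i = 0" for i
    by (simp add: w_def inner_diff_left tangent_part_inner assms(1))
  then show "a i \<bullet> unit_normal_towards a e = 0"
    by (simp add: unit_normal_towards_def sgn_div_norm inner_commute flip: w_def)
  have "w \<bullet> tangent_part a e = 0"
    using tangent_part_in_span[of a e] wa by (auto simp: inner_sum_right)
  then have "w \<bullet> e = w \<bullet> w" by (simp add: w_def inner_diff_right)
  then show "0 < unit_normal_towards a e \<bullet> e"
    using \<open>w \<noteq> 0\<close> by (simp add: unit_normal_towards_def sgn_div_norm flip: w_def)
qed

lemma unit_normal_unique:
  fixes a :: "'n::finite \<Rightarrow> real^'m"
  assumes "CARD('m) = CARD('n) + 1" "frame a"
    and "\<And>i. a i \<bullet> u = 0" "norm u = 1" "0 < u \<bullet> e"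
    and "\<And>i. a i \<bullet> v = 0" "norm v = 1" "0 < v \<bullet> e"
  shows "u = v"
proof -
  have v: "v = (v \<bullet> u) *\<^sub>R u" by (rule normal_direction_unique[OF assms(1-4,6)])
  then have "\<bar>v \<bullet> u\<bar> = 1" using assms(4,7) by (metis mult.right_neutral norm_scaleR)
  moreover have "v \<bullet> e = (v \<bullet> u) * (u \<bullet> e)" using v by (metis inner_scaleR_left)
  then have "0 < v \<bullet> u" using assms(5,8) by (simp add: zero_less_mult_iff)
  ultimately show ?thesis using v by simp
qed

lemma continuous_on_unit_normal_towards:
  fixes a :: "'x::topological_space \<Rightarrow> 'n::finite \<Rightarrow> 'a::real_inner"
  assumes "\<And>i. continuous_on S (\<lambda>z. a z i)" "continuous_on S e"
    and frame: "\<And>z. z \<in> S \<Longrightarrow> frame (a z)"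
    and transversal: "\<And>z v. z \<in> S \<Longrightarrow> (\<Sum>i\<in>UNIV. v $ i *\<^sub>R a z i) \<noteq> e z"
  shows "continuous_on S (\<lambda>z. unit_normal_towards (a z) (e z))"
  unfolding continuous_on_def
proof
  fix z assume z: "z \<in> S"
  have a: "((\<lambda>z. a z i) \<longlongrightarrow> a z i) (at z within S)" for i
    using assms(1) z by (simp add: continuous_on_def)
  have e: "(e \<longlongrightarrow> e z) (at z within S)"
    using assms(2) z by (simp add: continuous_on_def)
  have "((\<lambda>z. gram (a z) $ i $ j) \<longlongrightarrow> gram (a z) $ i $ j) (at z within S)" for i j
    unfolding gram_def vec_lambda_beta by (intro tendsto_intros a)
  then have G: "((\<lambda>z. matrix_inv (gram (a z)) $ i $ j) \<longlongrightarrow> matrix_inv (gram (a z)) $ i $ j)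
      (at z within S)" for i j
    by (rule tendsto_matrix_inv) (rule det_gram[OF frame[OF z]])
  have "((\<lambda>z. e z - tangent_part (a z) (e z)) \<longlongrightarrow> e z - tangent_part (a z) (e z)) (at z within S)"
    unfolding tangent_part_def
    by (intro tendsto_diff tendsto_sum tendsto_scaleR tendsto_mult tendsto_inner G a e)
  moreover have "e z - tangent_part (a z) (e z) \<noteq> 0"
    by (rule minus_tangent_part_nonzero) (rule transversal[OF z])
  ultimately show "((\<lambda>z. unit_normal_towards (a z) (e z)) \<longlongrightarrow> unit_normal_towards (a z) (e z))
      (at z within S)"
    unfolding unit_normal_towards_def by (rule tendsto_sgn)
qed

lemma in_chart_normal_variation:
  "in_chart c (normal_variation F N f t) =
    (\<lambda>y. in_chart c F y + t *\<^sub>R (in_chart c f y *\<^sub>R in_chart c N y))"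
  by (simp add: in_chart_def normal_variation_def fun_eq_iff)

lemma prescribed_hypersurface_patch:
  fixes \<psi> \<eta> :: "'p \<Rightarrow> real^'m" and c :: "('p, 'n::finite) chart"
  assumes "CARD('m) = CARD('n) + 1" "oriented_hypersurface 3 \<Sigma> A \<psi> \<eta>" "c \<in> A"
  shows "hypersurface_patch (crange c) (in_chart c \<psi>) (in_chart c \<eta>)"
proof -
  have "(3::nat) = Suc 2" by simp
  note c = oriented_hypersurface_chart[OF assms(2)[unfolded this] assms(3)]
  show ?thesis
  proof
    show "Ck_on 2 (crange c) (in_chart c \<psi>)" using c(3) by (rule Ck_on_SucD_lower)
    show "Ck_on 2 (crange c) (in_chart c \<eta>)"
      by (rule unit_normal_Ck[OF assms(1) c(2-7)])
  qed (use assms(1) c(2,4-6) in auto)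
qed

context
  fixes \<Sigma> :: "'p topology" and A :: "('p, 'n::finite) chart set"
    and \<psi> \<eta> :: "'p \<Rightarrow> real^'m::finite" and f :: "'p \<Rightarrow> real"
  assumes card: "CARD('m) = CARD('n) + 1"
    and oriented: "oriented_hypersurface 3 \<Sigma> A \<psi> \<eta>"
    and C2_f: "Ck_map 2 A f"
begin

abbreviation (input) V :: "real \<Rightarrow> 'p \<Rightarrow> real^'m" where
  "V \<equiv> normal_variation \<psi> \<eta> f"

abbreviation (input) \<phi> :: "('p, 'n) chart \<Rightarrow> real^'n \<Rightarrow> real^'m" where
  "\<phi> c \<equiv> \<lambda>y. in_chart c f y *\<^sub>R in_chart c \<eta> y"

lemma chart: "c \<in> A \<Longrightarrow> is_chart \<Sigma> c"
  and manifold: "Ck_manifold 3 \<Sigma> A"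
  and charts_cover: "topspace \<Sigma> = (\<Union>c\<in>A. cdom c)"
  using oriented by (auto simp: oriented_hypersurface_def Ck_manifold_def)

lemma C2_in_chart_f: "c \<in> A \<Longrightarrow> Ck_on 2 (crange c) (in_chart c f)"
  using C2_f by (simp add: Ck_map_def)

lemmas patch = prescribed_hypersurface_patch[OF card oriented]

lemma C2_\<phi>: "c \<in> A \<Longrightarrow> Ck_on 2 (crange c) (\<phi> c)"
  by (rule hypersurface_patch.variation_C2[OF patch C2_in_chart_f])

lemma C2_variation:
  assumes "c \<in> A"
  shows "Ck_on 2 (crange c) (in_chart c (V t))"
proof -
  interpret hypersurface_patch "crange c" "in_chart c \<psi>" "in_chart c \<eta>" by (rule patch[OF assms])
  show ?thesis
    unfolding in_chart_normal_variation
    by (rule Ck_on_add[OF open_U C2_\<psi> Ck_on_scaleR[OF open_U Ck_on_const C2_\<phi>[OF assms]]])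
qed

lemma differentiable_\<phi>:
  assumes "c \<in> A" "y \<in> crange c"
  shows "\<phi> c differentiable (at y)" "partial i (\<phi> c) differentiable (at y)"
  using C2_\<phi>[OF assms(1)] assms(2) by (auto simp: numeral_2_eq_2 partial_def[abs_def])

lemma partial_variation:
  assumes "c \<in> A" "y \<in> crange c"
  shows "partial i (in_chart c (V t)) y = partial i (in_chart c \<psi>) y + t *\<^sub>R partial i (\<phi> c) y"
proof -
  interpret hypersurface_patch "crange c" "in_chart c \<psi>" "in_chart c \<eta>" by (rule patch[OF assms(1)])
  have "(\<lambda>y. t *\<^sub>R \<phi> c y) differentiable (at y)"
    by (intro differentiable_scaleR differentiable_const differentiable_\<phi> assms)
  then show ?thesis
    unfolding in_chart_normal_variation
    using partial_add[OF differentiable_\<psi>(1)[OF assms(2)], of "\<lambda>y. t *\<^sub>R \<phi> c y"]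
      partial_scaleR_const[OF differentiable_\<phi>(1)[OF assms], of i t] by simp
qed

lemma partial_partial_variation:
  assumes "c \<in> A" "y \<in> crange c"
  shows "partial i (partial j (in_chart c (V t))) y
    = partial i (partial j (in_chart c \<psi>)) y + t *\<^sub>R partial i (partial j (\<phi> c)) y"
proof -
  interpret hypersurface_patch "crange c" "in_chart c \<psi>" "in_chart c \<eta>" by (rule patch[OF assms(1)])
  have d: "(\<lambda>y. t *\<^sub>R partial j (\<phi> c) y) differentiable (at y)"
    by (intro differentiable_scaleR differentiable_const differentiable_\<phi> assms)
  have "partial i (partial j (in_chart c (V t))) y
      = partial i (\<lambda>y. partial j (in_chart c \<psi>) y + t *\<^sub>R partial j (\<phi> c) y) y"
    by (rule partial_cong[OF _ open_U assms(2), symmetric])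
      (simp_all add: partial_variation assms(1) d differentiable_\<psi>(2)[OF assms(2)])
  also have "\<dots> = partial i (partial j (in_chart c \<psi>)) y + t *\<^sub>R partial i (partial j (\<phi> c)) y"
    using partial_add[OF differentiable_\<psi>(2)[OF assms(2)] d, of i j]
      partial_scaleR_const[OF differentiable_\<phi>(2)[OF assms], of i t j] by simp
  finally show ?thesis .
qed

text \<open>For small \<open>t\<close> the mean curvature of the variation is the trace
  differentiated in \<open>first_variation\<close>; the second term is the derivative of
  \<open>\<H>\<close> along the curve of normals in the sphere, with velocity \<open>-
  \<nabla>f\<close>.\<close>

lemma jacobi_operator:
  assumes \<H>: "C1_on_sphere \<H>" and "0 < \<epsilon>" and family: "unit_normal_family \<Sigma> A V \<eta> \<epsilon> \<nu>"
    and c: "c \<in> A" and p: "p \<in> cdom c"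
  shows "\<exists>D. ((\<lambda>t. mean_curvature c (V t) (\<nu> t) p - \<H> (\<nu> t p)) has_real_derivative D) (at 0) \<and>
    real CARD('n) * D = laplacian c \<psi> f p
      + (real CARD('n) *\<^sub>R sphere_gradient \<H> (\<eta> p)) \<bullet> gradient c \<psi> f p
      + sff_norm_sq c \<psi> \<eta> p * f p"
proof -
  interpret hypersurface_patch "crange c" "in_chart c \<psi>" "in_chart c \<eta>" by (rule patch[OF c])
  define x where "x = cmap c p"
  define n where "n = real CARD('n)"
  have n: "n \<noteq> 0" by (simp add: n_def)
  have x: "x \<in> crange c" using p by (simp add: x_def)
  have val: "in_chart c h x = h p" for h :: "'p \<Rightarrow> 'z"
    unfolding x_def by (rule in_chart_cmap[OF chart[OF c] p])
  have top: "p \<in> topspace \<Sigma>" using charts_cover c p by blast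
  define a where "a i = partial i (in_chart c \<psi>) x" for i
  define b where "b i = partial i (\<phi> c) x" for i
  define q where "q i j = partial i (partial j (in_chart c \<psi>)) x" for i j
  define r where "r i j = partial i (partial j (\<phi> c)) x" for i j
  define G where "G = matrix_inv (gram a)"
  have pt: "partial i (in_chart c (V t)) x = a i + t *\<^sub>R b i" for i t
    unfolding a_def b_def by (rule partial_variation[OF c x])
  have ppt: "partial i (partial j (in_chart c (V t))) x = q i j + t *\<^sub>R r i j" for i j t
    unfolding q_def r_def by (rule partial_partial_variation[OF c x])
  have V: "oriented_hypersurface 2 \<Sigma> A (V t) (\<nu> t)" if "\<bar>t\<bar> < \<epsilon>" for t
    using family that unfolding unit_normal_family_def by (auto simp: abs_less_iff)
  note Vc = oriented_hypersurface_chart[OF V[unfolded numeral_2_eq_2] c]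
  have contN: "continuous_on {-\<epsilon><..<\<epsilon>} (\<lambda>t. \<nu> t p)" and \<nu>0: "\<nu> 0 p = \<eta> p"
    using family top unfolding unit_normal_family_def by auto
  have cont: "isCont (\<lambda>t. \<nu> t p) 0"
    using contN \<open>0 < \<epsilon>\<close> by (simp add: continuous_on_eq_continuous_at)
  have frame_t: "frame (\<lambda>i. a i + t *\<^sub>R b i)" if "\<bar>t\<bar> < \<epsilon>" for t
    using Vc(4)[OF that x] by (simp only: pt)
  have normal_t: "(a i + t *\<^sub>R b i) \<bullet> \<nu> t p = 0" if "\<bar>t\<bar> < \<epsilon>" for t i
    using Vc(5)[OF that x] by (simp only: pt val)
  have unit_t: "norm (\<nu> t p) = 1" if "\<bar>t\<bar> < \<epsilon>" for t
    using Vc(6)[OF that x] by (simp only: val)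
  note variation = first_variation[OF C2_in_chart_f[OF c] x \<open>0 < \<epsilon>\<close>, of "\<lambda>t. \<nu> t p",
      folded a_def b_def q_def r_def, OF frame_t normal_t unit_t cont, unfolded val \<nu>0,
      OF _ _ _ refl, folded G_def]
  have inv: "inv_metric c \<psi> x = G"
    by (simp add: inv_metric_def metric_def G_def gram_def a_def[abs_def])
  have grad: "gradient c \<psi> f p
      = (\<Sum>i\<in>UNIV. \<Sum>j\<in>UNIV. (G $ i $ j * partial j (in_chart c f) x) *\<^sub>R a i)"
    by (simp add: gradient_def inv a_def flip: x_def)
  have sff: "second_fundamental_form c \<psi> \<eta> p $ i $ j = q i j \<bullet> \<eta> p" for i j
    by (simp add: second_fundamental_form_def q_def flip: x_def)
  have "metric c \<psi> y $ i $ j = gram (\<lambda>i. partial i (in_chart c \<psi>) y) $ i $ j" for y i j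
    by (simp add: metric_def gram_def)
  then have "christoffel c \<psi> x k i j = (\<Sum>l\<in>UNIV. G $ k $ l * (q i j \<bullet> a l))" for k i j
    unfolding christoffel_def inv
    by (simp only: christoffel_numerator[OF x] flip: q_def a_def) (simp add: sum_distrib_left sum_divide_distrib)
  then have lap: "laplacian c \<psi> f p = (\<Sum>i\<in>UNIV. \<Sum>j\<in>UNIV. G $ i $ j * (partial i (partial j (in_chart c f)) x
      - (\<Sum>k\<in>UNIV. (\<Sum>l\<in>UNIV. G $ k $ l * (q i j \<bullet> a l)) * partial k (in_chart c f) x)))"
    by (simp add: laplacian_def hessian_def inv flip: x_def)
  have norm: "sff_norm_sq c \<psi> \<eta> p = (\<Sum>i\<in>UNIV. \<Sum>j\<in>UNIV. \<Sum>k\<in>UNIV. \<Sum>l\<in>UNIV.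
      G $ i $ k * G $ j $ l * (q i j \<bullet> \<eta> p) * (q k l \<bullet> \<eta> p))"
    by (simp add: sff_norm_sq_def inv sff flip: x_def)
  let ?L = "laplacian c \<psi> f p + sff_norm_sq c \<psi> \<eta> p * f p"
  have "((\<lambda>t. trace (matrix_inv (gram (\<lambda>i. a i + t *\<^sub>R b i)) **
      (\<chi> i j. (q i j + t *\<^sub>R r i j) \<bullet> \<nu> t p))) has_real_derivative ?L) (at 0)"
    unfolding lap norm by (rule variation(2))
  from DERIV_cdivide[OF this, of n] have dH: "((\<lambda>t. mean_curvature c (V t) (\<nu> t) p) has_real_derivative ?L / n) (at 0)"
  proof (rule has_field_derivative_transform_within_open)
    show "trace (matrix_inv (gram (\<lambda>i. a i + t *\<^sub>R b i)) **
      (\<chi> i j. (q i j + t *\<^sub>R r i j) \<bullet> \<nu> t p)) / n = mean_curvature c (V t) (\<nu> t) p"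
      if "t \<in> {-\<epsilon><..<\<epsilon>}" for t
    proof -
      have "\<bar>t\<bar> < \<epsilon>" using that by (simp add: abs_less_iff)
      from mean_curvature_eq_trace[OF V[OF this] c p, folded x_def n_def, unfolded pt ppt]
      show ?thesis using n by (simp add: field_simps)
    qed
  qed (use \<open>0 < \<epsilon>\<close> in auto)
  have unit0: "\<eta> p \<in> sphere 0 1" using unit_t[of 0] \<open>0 < \<epsilon>\<close> \<nu>0 by simp
  have "((\<lambda>t. \<H> (\<nu> t p)) has_real_derivative
      sphere_gradient \<H> (\<eta> p) \<bullet> (- gradient c \<psi> f p)) (at 0)"
  proof (rule sphere_derivative_along_curve)
    show "(\<H> has_derivative (\<lambda>w. sphere_gradient \<H> (\<eta> p) \<bullet> w)) (at (\<nu> 0 p) within sphere 0 1)"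
      using sphere_gradient_is_sphere_gradient[OF \<H> unit0]
      unfolding \<nu>0 is_sphere_gradient_def by blast
    show "((\<lambda>t. \<nu> t p) has_vector_derivative - gradient c \<psi> f p) (at 0)"
      unfolding grad by (rule variation(1))
    show "\<nu> t p \<in> sphere 0 1" if "t \<in> {-\<epsilon><..<\<epsilon>}" for t
      using unit_t[of t] that by (simp add: abs_less_iff)
  qed (use \<open>0 < \<epsilon>\<close> in auto)
  note deriv = DERIV_diff[OF dH this]
  show ?thesis
    by (rule exI, rule conjI, rule deriv) (simp add: n distrib_left add_divide_distrib flip: n_def)
qed

section \<open>Transversality and existence of the unit normals\<close>

text \<open>The multiples of \<open>\<eta> p\<close> include \<open>0\<close>, so this contains
  injectivity of the derivative of the variation as well as the fact that \<open>\<eta> p\<close> is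
  not tangent to the varied hypersurface.\<close>

definition transversal :: "('p, 'n) chart \<Rightarrow> real \<Rightarrow> 'p \<Rightarrow> bool" where
  "transversal c t p \<longleftrightarrow>
    (\<forall>v s. frechet_derivative (in_chart c (V t)) (at (cmap c p)) v = s *\<^sub>R \<eta> p \<longrightarrow> v = 0)"

lemma differentiable_variation:
  assumes "c \<in> A" "p \<in> cdom c"
  shows "in_chart c (V t) differentiable (at (cmap c p))"
  using C2_variation[OF assms(1), of t] assms(2) by (simp add: numeral_2_eq_2)

lemma transversalD:
  assumes "transversal c t p" "c \<in> A" "p \<in> cdom c"
  shows "frame (\<lambda>i. partial i (in_chart c (V t)) (cmap c p))"
    and "(\<Sum>i\<in>UNIV. v $ i *\<^sub>R partial i (in_chart c (V t)) (cmap c p)) \<noteq> \<eta> p"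
proof -
  note D = frechet_derivative_partials[OF differentiable_variation[OF assms(2,3)], symmetric]
  show "frame (\<lambda>i. partial i (in_chart c (V t)) (cmap c p))"
    unfolding frame_def D
  proof (intro allI impI)
    fix v assume "frechet_derivative (in_chart c (V t)) (at (cmap c p)) v = 0"
    then show "v = 0" using assms(1) unfolding transversal_def by (metis scaleR_zero_left)
  qed
  interpret hypersurface_patch "crange c" "in_chart c \<psi>" "in_chart c \<eta>" by (rule patch[OF assms(2)])
  have "norm (\<eta> p) = 1"
    using unit[of "cmap c p"] assms(3) by (simp add: in_chart_cmap[OF chart[OF assms(2)]])
  then have "\<eta> p \<noteq> 0" by force
  show "(\<Sum>i\<in>UNIV. v $ i *\<^sub>R partial i (in_chart c (V t)) (cmap c p)) \<noteq> \<eta> p"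
    unfolding D
  proof
    assume eq: "frechet_derivative (in_chart c (V t)) (at (cmap c p)) v = \<eta> p"
    then have "v = 0" using assms(1) unfolding transversal_def by (metis scaleR_one)
    moreover have "frechet_derivative (in_chart c (V t)) (at (cmap c p)) 0 = 0"
      by (rule linear_0[OF linear_frechet_derivative[OF differentiable_variation[OF assms(2,3)]]])
    ultimately show False using eq \<open>\<eta> p \<noteq> 0\<close> by simp
  qed
qed

text \<open>The derivative of the immersion \<open>\<psi>\<close> is injective and factors through
  that of the transition map, which is therefore injective too.\<close>

lemma transversal_change_of_chart:
  assumes "transversal c t p" "c \<in> A" "p \<in> cdom c" "d \<in> A" "p \<in> cdom d"
  shows "transversal d t p"
  unfolding transversal_def
proof (intro allI impI)
  fix v s assume eq: "frechet_derivative (in_chart d (V t)) (at (cmap d p)) v = s *\<^sub>R \<eta> p"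
  have man: "Ck_manifold (Suc 2) \<Sigma> A" using manifold by simp
  define T where "T = frechet_derivative (in_chart d (cmap c)) (at (cmap d p))"
  interpret c: hypersurface_patch "crange c" "in_chart c \<psi>" "in_chart c \<eta>" by (rule patch[OF assms(2)])
  interpret d: hypersurface_patch "crange d" "in_chart d \<psi>" "in_chart d \<eta>" by (rule patch[OF assms(4)])
  have c\<psi>: "in_chart c \<psi> differentiable (at (cmap c p))"
    by (rule c.differentiable_\<psi>) (use assms(3) in blast)
  have d\<psi>: "in_chart d \<psi> differentiable (at (cmap d p))"
    by (rule d.differentiable_\<psi>) (use assms(5) in blast)
  have "frechet_derivative (in_chart d (V t)) (at (cmap d p)) v
      = frechet_derivative (in_chart c (V t)) (at (cmap c p)) (T v)"
    unfolding T_def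
    by (subst frechet_derivative_change_of_chart[OF man assms(4,2,5,3)
          differentiable_variation[OF assms(2,3)]]) simp
  then have "T v = 0" using eq assms(1) unfolding transversal_def by metis
  have "frechet_derivative (in_chart d \<psi>) (at (cmap d p)) v
      = frechet_derivative (in_chart c \<psi>) (at (cmap c p)) (T v)"
    unfolding T_def
    by (subst frechet_derivative_change_of_chart[OF man assms(4,2,5,3) c\<psi>]) simp
  also have "\<dots> = 0"
    unfolding \<open>T v = 0\<close> by (rule linear_0[OF linear_frechet_derivative[OF c\<psi>]])
  finally show "v = 0"
    using d.frame[of "cmap d p"] assms(5)
    unfolding frame_def frechet_derivative_partials[OF d\<psi>] by blast
qed

text \<open>Pairs the frame of the hypersurface with the frame of the variation. Its determinant is
  continuous in \<open>(y, t)\<close> jointly and equals the Gram determinant at \<open>t =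
  0\<close>, which makes transversality an open condition.\<close>

definition mixed_gram :: "('p, 'n) chart \<Rightarrow> real \<Rightarrow> real^'n \<Rightarrow> real^'n^'n" where
  "mixed_gram c t y = (\<chi> i j. partial i (in_chart c \<psi>) y \<bullet> partial j (in_chart c (V t)) y)"

text \<open>The inner product with the frame of the hypersurface annihilates multiples of
  \<open>\<eta> p\<close>.\<close>

lemma transversal_if_det_mixed_gram:
  assumes "c \<in> A" "p \<in> cdom c" "det (mixed_gram c t (cmap c p)) \<noteq> 0"
  shows "transversal c t p"
  unfolding transversal_def
proof (intro allI impI)
  fix v s
  interpret hypersurface_patch "crange c" "in_chart c \<psi>" "in_chart c \<eta>" by (rule patch[OF assms(1)])
  assume "frechet_derivative (in_chart c (V t)) (at (cmap c p)) v = s *\<^sub>R \<eta> p"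
  then have eq: "(\<Sum>j\<in>UNIV. v $ j *\<^sub>R partial j (in_chart c (V t)) (cmap c p)) = s *\<^sub>R \<eta> p"
    by (simp add: frechet_derivative_partials[OF differentiable_variation[OF assms(1,2)]])
  have "(mixed_gram c t (cmap c p) *v v) $ i = 0" for i
  proof -
    have "(mixed_gram c t (cmap c p) *v v) $ i = partial i (in_chart c \<psi>) (cmap c p)
        \<bullet> (\<Sum>j\<in>UNIV. v $ j *\<^sub>R partial j (in_chart c (V t)) (cmap c p))"
      by (simp add: mixed_gram_def matrix_vector_mult_def inner_sum_right mult.commute)
    also have "\<dots> = 0"
      unfolding eq using normal[of "cmap c p" i] assms(2)
      by (simp add: in_chart_cmap[OF chart[OF assms(1)]])
    finally show ?thesis .
  qed
  then have "mixed_gram c t (cmap c p) *v v = 0" by (simp add: vec_eq_iff)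
  moreover have "\<exists>B. B ** mixed_gram c t (cmap c p) = mat 1"
    using assms(3) by (simp add: invertible_det_nz[symmetric] invertible_left_inverse)
  ultimately show "v = 0" by (simp add: matrix_left_invertible_ker)
qed

text \<open>Covers both \<open>t = 0\<close> and the points near which \<open>f\<close>
  vanishes.\<close>

lemma det_mixed_gram_stationary:
  assumes "c \<in> A" "p \<in> cdom c" "\<And>j. t *\<^sub>R partial j (\<phi> c) (cmap c p) = 0"
  shows "det (mixed_gram c t (cmap c p)) \<noteq> 0"
proof -
  interpret hypersurface_patch "crange c" "in_chart c \<psi>" "in_chart c \<eta>" by (rule patch[OF assms(1)])
  have x: "cmap c p \<in> crange c" using assms(2) by blast
  have "mixed_gram c t (cmap c p) = gram (\<lambda>i. partial i (in_chart c \<psi>) (cmap c p))"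
    by (simp only: mixed_gram_def gram_def partial_variation[OF assms(1) x] assms(3) add_0_right)
  then show ?thesis using det_gram[OF frame[OF x]] by simp
qed

lemma locally_transversal:
  assumes "p \<in> topspace \<Sigma>"
  obtains W \<delta> where "openin \<Sigma> W" "p \<in> W" "0 < \<delta>"
    "\<forall>q\<in>W. \<forall>t. \<bar>t\<bar> < \<delta> \<longrightarrow> (\<exists>c\<in>A. q \<in> cdom c \<and> transversal c t q)"
proof -
  obtain c where c: "c \<in> A" "p \<in> cdom c" using assms charts_cover by blast
  interpret hypersurface_patch "crange c" "in_chart c \<psi>" "in_chart c \<eta>" by (rule patch[OF c(1)])
  let ?S = "crange c \<times> (UNIV :: real set)"
  let ?D = "\<lambda>z. det (mixed_gram c (snd z) (fst z))"
  have C1: "Ck_on (Suc 1) (crange c) (in_chart c \<psi>)" "Ck_on (Suc 1) (crange c) (\<phi> c)"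
    using C2_\<psi> C2_\<phi>[OF c(1)] by (simp_all only: Suc_1)
  have cont: "continuous_on ?S (\<lambda>z. partial i (in_chart c \<psi>) (fst z))"
    "continuous_on ?S (\<lambda>z. partial i (\<phi> c) (fst z))" for i
    by (rule continuous_on_compose2[OF Ck_on_continuous[OF Ck_on_partial] continuous_on_fst[OF continuous_on_id]],
        rule C1, force)+
  have "continuous_on ?S (\<lambda>z. partial i (in_chart c \<psi>) (fst z)
      \<bullet> (partial j (in_chart c \<psi>) (fst z) + snd z *\<^sub>R partial j (\<phi> c) (fst z)))" for i j
    by (intro continuous_intros cont)
  then have "continuous_on ?S (\<lambda>z. mixed_gram c (snd z) (fst z) $ i $ j)" for i j
    by (rule continuous_on_eq) (auto simp: mixed_gram_def partial_variation[OF c(1)])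
  then have "continuous_on ?S ?D"
    unfolding continuous_on_def by (intro ballI tendsto_det) blast
  then have "open (?S \<inter> ?D -` (- {0}))"
    by (rule continuous_open_preimage) (auto intro: open_Times open_U)
  moreover have "(cmap c p, 0) \<in> ?S \<inter> ?D -` (- {0})"
    using det_mixed_gram_stationary[OF c, of 0] c(2) by auto
  ultimately obtain P Q where PQ: "open P" "open Q" "cmap c p \<in> P" "0 \<in> Q"
    "P \<times> Q \<subseteq> ?S \<inter> ?D -` (- {0})"
    by (auto elim!: open_prod_elim)
  obtain \<delta> where \<delta>: "0 < \<delta>" "\<And>t. \<bar>t\<bar> < \<delta> \<Longrightarrow> t \<in> Q"
    using PQ(2,4) unfolding open_dist by (auto simp: dist_real_def)
  show thesis
  proof
    show "openin \<Sigma> {q \<in> cdom c. cmap c q \<in> P}"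
      by (rule chart_openin_preimage[OF chart[OF c(1)] PQ(1)])
    show "p \<in> {q \<in> cdom c. cmap c q \<in> P}" using c(2) PQ(3) by simp
    show "0 < \<delta>" by fact
    show "\<forall>q\<in>{q \<in> cdom c. cmap c q \<in> P}. \<forall>t. \<bar>t\<bar> < \<delta> \<longrightarrow>
        (\<exists>c\<in>A. q \<in> cdom c \<and> transversal c t q)"
    proof (intro ballI allI impI)
      fix q t assume q: "q \<in> {q \<in> cdom c. cmap c q \<in> P}" and t: "\<bar>t\<bar> < \<delta>"
      have "(cmap c q, t) \<in> P \<times> Q" using q \<delta>(2)[OF t] by simp
      then have "(cmap c q, t) \<in> ?S \<inter> ?D -` (- {0})" using PQ(5) by blast
      then have "transversal c t q"
        using q by (intro transversal_if_det_mixed_gram[OF c(1)]) auto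
      then show "\<exists>c\<in>A. q \<in> cdom c \<and> transversal c t q" using c(1) q by blast
    qed
  qed
qed

lemma transversal_off_support:
  assumes "p \<in> topspace \<Sigma>" "p \<notin> \<Sigma> closure_of {p \<in> topspace \<Sigma>. f p \<noteq> 0}"
  shows "\<exists>c\<in>A. p \<in> cdom c \<and> transversal c t p"
proof -
  let ?K = "\<Sigma> closure_of {p \<in> topspace \<Sigma>. f p \<noteq> 0}"
  obtain c where c: "c \<in> A" "p \<in> cdom c" using assms(1) charts_cover by blast
  have opn: "openin \<Sigma> (cdom c - ?K)"
    using chart[OF c(1)] by (intro openin_diff closedin_closure_of) (simp add: is_chart_def)
  have zero: "\<phi> c y = 0" if y: "y \<in> cmap c ` (cdom c - ?K)" for y
  proof -
    obtain q where q: "q \<in> cdom c" "q \<notin> ?K" "y = cmap c q" using y by blast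
    have "q \<in> topspace \<Sigma>" using q(1) c(1) charts_cover by blast
    then have "f q = 0"
      using q(2) closure_of_subset[of "{p \<in> topspace \<Sigma>. f p \<noteq> 0}" \<Sigma>] by blast
    then show ?thesis by (simp add: q in_chart_cmap[OF chart[OF c(1)]])
  qed
  have x: "cmap c p \<in> crange c" using c(2) by blast
  have "partial j (\<phi> c) (cmap c p) = partial j (\<lambda>_. 0) (cmap c p)" for j
    by (rule partial_cong[OF differentiable_\<phi>(1)[OF c(1) x]
          chart_open_image[OF chart[OF c(1)] opn] _ zero]) (use c(2) assms(2) in auto)
  then have "transversal c t p"
    by (intro transversal_if_det_mixed_gram[OF c] det_mixed_gram_stationary[OF c]) simp
  then show ?thesis using c by blast
qed

text \<open>On the support finitely many neighbourhoods suffice, each with its own bound for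
  \<open>t\<close>; off the support every \<open>t\<close> is allowed.\<close>

lemma uniformly_transversal:
  assumes "compact_support \<Sigma> f"
  obtains \<epsilon> where "0 < \<epsilon>"
    "\<And>c p t. c \<in> A \<Longrightarrow> p \<in> cdom c \<Longrightarrow> \<bar>t\<bar> < \<epsilon> \<Longrightarrow> transversal c t p"
proof -
  let ?K = "\<Sigma> closure_of {p \<in> topspace \<Sigma>. f p \<noteq> 0}"
  define good where "good W \<delta> \<longleftrightarrow> 0 < \<delta> \<and>
    (\<forall>q\<in>W. \<forall>t. \<bar>t\<bar> < \<delta> \<longrightarrow> (\<exists>c\<in>A. q \<in> cdom c \<and> transversal c t q))" for W and \<delta> :: real
  define \<W> where "\<W> = {W. openin \<Sigma> W \<and> (\<exists>\<delta>. good W \<delta>)}"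
  have K: "compactin \<Sigma> ?K" using assms by (simp add: compact_support_def)
  have "?K \<subseteq> \<Union>\<W>"
  proof
    fix p assume "p \<in> ?K"
    then have "p \<in> topspace \<Sigma>" by (rule subsetD[OF closure_of_subset_topspace])
    then obtain W \<delta> where "openin \<Sigma> W" "p \<in> W" "0 < \<delta>"
      "\<forall>q\<in>W. \<forall>t. \<bar>t\<bar> < \<delta> \<longrightarrow> (\<exists>c\<in>A. q \<in> cdom c \<and> transversal c t q)"
      by (rule locally_transversal)
    then show "p \<in> \<Union>\<W>" unfolding \<W>_def good_def by blast
  qed
  then obtain \<F> where \<F>: "finite \<F>" "\<F> \<subseteq> \<W>" "?K \<subseteq> \<Union>\<F>"
    using K unfolding compactin_def \<W>_def by (metis (mono_tags, lifting) mem_Collect_eq)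
  have "\<forall>W\<in>\<F>. \<exists>\<delta>. good W \<delta>" using \<F>(2) unfolding \<W>_def by blast
  then obtain \<delta> where \<delta>: "\<And>W. W \<in> \<F> \<Longrightarrow> good W (\<delta> W)" by metis
  define \<epsilon> where "\<epsilon> = Min (insert 1 (\<delta> ` \<F>))"
  show thesis
  proof
    show "0 < \<epsilon>" using \<F>(1) \<delta> by (auto simp: \<epsilon>_def good_def)
    fix c p and t :: real assume c: "c \<in> A" "p \<in> cdom c" and t: "\<bar>t\<bar> < \<epsilon>"
    have p: "p \<in> topspace \<Sigma>" using c charts_cover by blast
    have "\<exists>d\<in>A. p \<in> cdom d \<and> transversal d t p"
    proof (cases "p \<in> ?K")
      case True
      then obtain W where W: "W \<in> \<F>" "p \<in> W" using \<F>(3) by blast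
      then have "\<bar>t\<bar> < \<delta> W" using t \<F>(1) by (simp add: \<epsilon>_def)
      then show ?thesis using \<delta>[OF W(1)] W(2) unfolding good_def by blast
    next
      case False
      then show ?thesis using transversal_off_support[OF p] by blast
    qed
    then show "transversal c t p" using transversal_change_of_chart c by blast
  qed
qed

definition variation_normal :: "('p, 'n) chart \<Rightarrow> real \<Rightarrow> 'p \<Rightarrow> real^'m" where
  "variation_normal c t p = unit_normal_towards (\<lambda>i. partial i (in_chart c (V t)) (cmap c p)) (\<eta> p)"

lemma variation_normal:
  assumes "transversal c t p" "c \<in> A" "p \<in> cdom c"
  shows "norm (variation_normal c t p) = 1" "0 < variation_normal c t p \<bullet> \<eta> p"
    and "frechet_derivative (in_chart c (V t)) (at (cmap c p)) v \<bullet> variation_normal c t p = 0"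
proof -
  note u = unit_normal_towards[OF transversalD[OF assms], folded variation_normal_def]
  show "norm (variation_normal c t p) = 1" "0 < variation_normal c t p \<bullet> \<eta> p"
    by (rule u)+
  show "frechet_derivative (in_chart c (V t)) (at (cmap c p)) v \<bullet> variation_normal c t p = 0"
    by (simp add: frechet_derivative_partials[OF differentiable_variation[OF assms(2,3)]]
        inner_sum_left u(2))
qed

lemma variation_normal_change_of_chart:
  assumes "transversal c t p" "transversal d t p" "c \<in> A" "p \<in> cdom c" "d \<in> A" "p \<in> cdom d"
  shows "variation_normal c t p = variation_normal d t p"
proof (rule unit_normal_unique[OF card transversalD(1)[OF assms(1,3,4)]])
  have man: "Ck_manifold (Suc 2) \<Sigma> A" using manifold by simp
  show "partial i (in_chart c (V t)) (cmap c p) \<bullet> variation_normal c t p = 0" for i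
    unfolding partial_def by (rule variation_normal(3)[OF assms(1,3,4)])
  show "partial i (in_chart c (V t)) (cmap c p) \<bullet> variation_normal d t p = 0" for i
    unfolding partial_def frechet_derivative_change_of_chart[OF man assms(3,5,4,6)
        differentiable_variation[OF assms(5,6)]] comp_apply
    by (rule variation_normal(3)[OF assms(2,5,6)])
qed (use variation_normal assms in blast)+

lemma variation_normal_0:
  assumes "c \<in> A" "p \<in> cdom c"
  shows "variation_normal c 0 p = \<eta> p"
proof -
  interpret hypersurface_patch "crange c" "in_chart c \<psi>" "in_chart c \<eta>" by (rule patch[OF assms(1)])
  have x: "cmap c p \<in> crange c" using assms(2) by blast
  have val: "in_chart c \<eta> (cmap c p) = \<eta> p" by (rule in_chart_cmap[OF chart[OF assms(1)] assms(2)])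
  have "\<eta> p \<bullet> partial i (in_chart c \<psi>) (cmap c p) = 0" for i
    using normal[OF x, of i] by (simp add: val inner_commute)
  then show ?thesis
    using unit[OF x]
    by (simp add: variation_normal_def unit_normal_towards_def tangent_part_def
        partial_variation[OF assms(1) x] val sgn_div_norm)
qed

text \<open>At each point the normal is computed in some chart around it; the result does not depend
  on the chart because the unit normal on the side of \<open>\<eta> p\<close> is unique. Continuity
  along the hypersurface and in \<open>t\<close> is read off from the same formula.\<close>

lemma unit_normal_family_exists:
  assumes "compact_support \<Sigma> f"
  shows "\<exists>\<epsilon>>0. \<exists>\<nu>. unit_normal_family \<Sigma> A V \<eta> \<epsilon> \<nu>"
proof -
  obtain \<epsilon> where \<epsilon>: "0 < \<epsilon>"
    and trans: "\<And>c p t. c \<in> A \<Longrightarrow> p \<in> cdom c \<Longrightarrow> \<bar>t\<bar> < \<epsilon> \<Longrightarrow> transversal c t p"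
    using uniformly_transversal[OF assms] by blast
  define C where "C p = (SOME c. c \<in> A \<and> p \<in> cdom c)" for p
  define \<nu> where "\<nu> t p = variation_normal (C p) t p" for t p
  have C: "C p \<in> A" "p \<in> cdom (C p)" if "c \<in> A" "p \<in> cdom c" for c p
    using someI[of "\<lambda>c. c \<in> A \<and> p \<in> cdom c" c] that unfolding C_def by blast+
  have \<nu>: "\<nu> t p = variation_normal c t p" if "c \<in> A" "p \<in> cdom c" "\<bar>t\<bar> < \<epsilon>" for c p t
    unfolding \<nu>_def using C[OF that(1,2)] that
    by (intro variation_normal_change_of_chart trans)
  have hyp: "oriented_hypersurface 2 \<Sigma> A (V t) (\<nu> t)" if t: "\<bar>t\<bar> < \<epsilon>" for t
    unfolding oriented_hypersurface_def
  proof (intro conjI ballI allI)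
    have "Ck_on 2 S g" if "Ck_on 3 S g" for S and g :: "real^'n \<Rightarrow> real^'n"
      by (rule Ck_on_le[OF _ that]) simp
    then show "Ck_manifold 2 \<Sigma> A"
      using manifold unfolding Ck_manifold_def by blast
    show "Ck_map 2 A (V t)" using C2_variation by (simp add: Ck_map_def)
    show "inj (frechet_derivative (in_chart c (V t)) (at x))"
      if c: "c \<in> A" and x: "x \<in> crange c" for c x
    proof -
      obtain p where p: "p \<in> cdom c" "x = cmap c p" using x by blast
      show ?thesis
        using transversalD(1)[OF trans[OF c p(1) t] c p(1)]
        by (simp add: p(2) frame_iff_inj_frechet_derivative differentiable_variation[OF c p(1)])
    qed
    show "continuous_map \<Sigma> euclidean (\<nu> t)"
    proof (rule continuous_map_in_charts)
      fix p assume "p \<in> topspace \<Sigma>"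
      then obtain c where c: "c \<in> A" "p \<in> cdom c" using charts_cover by blast
      interpret hypersurface_patch "crange c" "in_chart c \<psi>" "in_chart c \<eta>"
        by (rule patch[OF c(1)])
      have C1: "Ck_on (Suc 1) (crange c) (in_chart c (V t))"
        using C2_variation[OF c(1)] by (simp only: Suc_1)
      have tr: "frame (\<lambda>i. partial i (in_chart c (V t)) y)"
        "(\<Sum>i\<in>UNIV. v $ i *\<^sub>R partial i (in_chart c (V t)) y) \<noteq> in_chart c \<eta> y"
        if y: "y \<in> crange c" for y v
      proof -
        obtain q where q: "q \<in> cdom c" "y = cmap c q" using y by blast
        note transversalD[OF trans[OF c(1) q(1) t] c(1) q(1)]
        then show "frame (\<lambda>i. partial i (in_chart c (V t)) y)"
          "(\<Sum>i\<in>UNIV. v $ i *\<^sub>R partial i (in_chart c (V t)) y) \<noteq> in_chart c \<eta> y"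
          by (simp_all add: q in_chart_cmap[OF chart[OF c(1)]])
      qed
      have "continuous_on (crange c)
          (\<lambda>y. unit_normal_towards (\<lambda>i. partial i (in_chart c (V t)) y) (in_chart c \<eta> y))"
        by (rule continuous_on_unit_normal_towards[OF Ck_on_continuous[OF Ck_on_partial[OF C1]]
              Ck_on_continuous[OF C2_\<eta>] tr])
      then have "continuous_on (crange c) (in_chart c (\<nu> t))"
        by (rule continuous_on_eq)
          (auto simp: in_chart_cmap[OF chart[OF c(1)]] \<nu>[OF c(1) _ t] variation_normal_def)
      then show "\<exists>c::('p, 'n) chart. is_chart \<Sigma> c \<and> p \<in> cdom c \<and> continuous_on (crange c) (in_chart c (\<nu> t))"
        using chart[OF c(1)] c(2) by blast
    qed
    show "norm (\<nu> t p) = 1" if p: "p \<in> topspace \<Sigma>" for p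
    proof -
      obtain c where c: "c \<in> A" "p \<in> cdom c" using p charts_cover by blast
      show ?thesis unfolding \<nu>[OF c t] by (rule variation_normal(1)[OF trans[OF c t] c])
    qed
    show "frechet_derivative (in_chart c (V t)) (at (cmap c p)) v \<bullet> \<nu> t p = 0"
      if c: "c \<in> A" "p \<in> cdom c" for c p v
      unfolding \<nu>[OF c t] by (rule variation_normal(3)[OF trans[OF c t] c])
  qed
  have "continuous_on {-\<epsilon><..<\<epsilon>} (\<lambda>t. \<nu> t p) \<and> \<nu> 0 p = \<eta> p" if p: "p \<in> topspace \<Sigma>" for p
  proof
    obtain c where c: "c \<in> A" "p \<in> cdom c" using p charts_cover by blast
    have x: "cmap c p \<in> crange c" using c(2) by blast
    show "\<nu> 0 p = \<eta> p" using \<nu>[OF c, of 0] \<epsilon> variation_normal_0[OF c] by simp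
    have "continuous_on {-\<epsilon><..<\<epsilon>}
        (\<lambda>t. unit_normal_towards (\<lambda>i. partial i (in_chart c (V t)) (cmap c p)) (\<eta> p))"
    proof (rule continuous_on_unit_normal_towards)
      show "continuous_on {-\<epsilon><..<\<epsilon>} (\<lambda>t. partial i (in_chart c (V t)) (cmap c p))" for i
        unfolding partial_variation[OF c(1) x] by (intro continuous_intros)
      show "frame (\<lambda>i. partial i (in_chart c (V t)) (cmap c p))"
        "(\<Sum>i\<in>UNIV. v $ i *\<^sub>R partial i (in_chart c (V t)) (cmap c p)) \<noteq> \<eta> p"
        if "t \<in> {-\<epsilon><..<\<epsilon>}" for t v
      proof -
        have "\<bar>t\<bar> < \<epsilon>" using that by (simp add: abs_less_iff)
        from transversalD[OF trans[OF c this] c]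
        show "frame (\<lambda>i. partial i (in_chart c (V t)) (cmap c p))"
          "(\<Sum>i\<in>UNIV. v $ i *\<^sub>R partial i (in_chart c (V t)) (cmap c p)) \<noteq> \<eta> p" .
      qed
    qed (rule continuous_on_const)
    then show "continuous_on {-\<epsilon><..<\<epsilon>} (\<lambda>t. \<nu> t p)"
      by (rule continuous_on_eq) (simp add: \<nu>[OF c] variation_normal_def abs_less_iff)
  qed
  then have "unit_normal_family \<Sigma> A V \<eta> \<epsilon> \<nu>"
    unfolding unit_normal_family_def by (auto intro: hyp simp: abs_less_iff)
  then show ?thesis using \<epsilon> by blast
qed

end

theorem proposition4p1:
  fixes \<Sigma> :: "'p topology"
    and A :: "('p, 'n::finite) chart set"
    and \<psi> \<eta> :: "'p \<Rightarrow> real^'m::finite"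
    and \<H> :: "real^'m \<Rightarrow> real"
    and f :: "'p \<Rightarrow> real"
  assumes "CARD('m) = CARD('n) + 1"
    and "C1_on_sphere \<H>"
    and "prescribed_hypersurface \<H> \<Sigma> A \<psi> \<eta>"
    and "Ck_map 2 A f"
    and "compact_support \<Sigma> f"
  shows "(\<exists>\<epsilon>>0. \<exists>\<nu>. unit_normal_family \<Sigma> A (normal_variation \<psi> \<eta> f) \<eta> \<epsilon> \<nu>) \<and>
    (\<forall>\<epsilon>>0. \<forall>\<nu>. unit_normal_family \<Sigma> A (normal_variation \<psi> \<eta> f) \<eta> \<epsilon> \<nu> \<longrightarrow>
      (\<forall>c\<in>A. \<forall>p\<in>cdom c.
        \<exists>D. ((\<lambda>t. mean_curvature c (normal_variation \<psi> \<eta> f t) (\<nu> t) p - \<H> (\<nu> t p))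
                has_real_derivative D) (at 0) \<and>
            real CARD('n) * D =
              laplacian c \<psi> f p
              + (real CARD('n) *\<^sub>R sphere_gradient \<H> (\<eta> p)) \<bullet> gradient c \<psi> f p
              + sff_norm_sq c \<psi> \<eta> p * f p))"
proof -
  have oriented: "oriented_hypersurface 3 \<Sigma> A \<psi> \<eta>"
    using assms(3) by (simp add: prescribed_hypersurface_def)
  show ?thesis
    using unit_normal_family_exists[OF assms(1) oriented assms(4,5)]
      jacobi_operator[OF assms(1) oriented assms(4,2)] by blast
qed

end
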